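(* Let $n, m \in \mathbb{N}$ with $m \leq n$ and let $k_1,\ldots,k_m \in \mathbb{N}$ be such that $0 < k_1 < \ldots < k_m \leq n$. Let $(a_i)_{i=1}^m, (b_i)_{i=1}^m \subseteq \mathbb{R} \cup \{\pm\infty\}$ be such that for all $i \in \{1,\ldots,m\}$, $a_i \leq b_i$, $a_i \neq \infty$ and $b_i \neq -\infty$. Set $$K:=\left\{ \sum_{i=0}^n c_iX^i \in P_n \;\middle|\; \text{for all }i \in \{1,\ldots,m\},\ a_i \leq c_{k_i} \leq b_i\right\}.$$ Let $p_0 \in K$. Let $f: [0,1] \to \mathbb{R}$ and let $\omega : (0, \infty) \to (0,\infty)$ be a modulus of uniform continuity for $f$. Set $M:=\frac52\|f\| + \frac32\|p_0\|$. Let $y \in K$ be such that $E:=\|f-y\|=\min_{q \in K}\|f-q\|$, assume $E>0$, and let $L\in(0,E]$. Put $$\gamma := \frac{\left(\frac{\chi_{\omega,n,M}\left(\frac{L}2\right)}2\right)^{\frac{n^2}2+2n}}{10 \cdot N_n^2\,(n+1)(nF_n+1)} .$$ Then $\gamma>0$ is a constant of strong unicity, i.e. for all $p\in K$, $$\|f-p\|\geq E+\gamma\,\|p-y\|.$$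
   Context: $\mathbb{N}$ includes $0$, and the convention $0^0=1$ is used. $P_n$ is the set of real polynomials of degree at most $n$, and $\|\cdot\|$ is the supremum norm on $[0,1]$. A modulus of uniform continuity for $f:[0,1]\to\mathbb{R}$ is a function $\omega:(0,\infty)\to(0,\infty)$ such that for any $\varepsilon>0$ and any $x,y\in[0,1]$ with $|x-y|<\omega(\varepsilon)$ one has $|f(x)-f(y)|<\varepsilon$. For $\omega:(0,\infty)\to(0,\infty)$, $n\in\mathbb{N}$, $M\geq 0$ and $\varepsilon>0$, $$\chi_{\omega,n,M}(\varepsilon):=\min\left(1,\frac{\varepsilon}{4n^2M+1},\omega\left(\frac{\varepsilon}{2}\right)\right).$$ For $n\in\mathbb{N}$, $F_n:=\frac32\max_{i\in\{0,\ldots,n\}}\frac{(2n^2)^i}{i!}$. For a strictly decreasing sequence $h=(h_1>\ldots>h_{r+1})$ of natural numbers, put $\lambda^h_i:=h_i+i-r-1$ for $1\leq i\leq r+1$ (a weakly decreasing sequence of natural numbers). For a weakly decreasing sequence $\lambda=(\lambda_1\geq\ldots\geq\lambda_{r+1})$ of natural numbers put $N_\lambda:=\prod_{1\leq i<j\leq r+1}\frac{\lambda_i-\lambda_j+j-i}{j-i}$. For $n\in\mathbb{N}$, $N_n$ is the maximum of $N_{\lambda^h}$ over all (finitely many) nonempty strictly decreasing sequences $h$ of natural numbers of length at most $n+1$ with $h_1\leq n$. *)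

theory Defs
  imports
    Complex_Main
    "HOL-Library.Extended_Real"
    "HOL-Computational_Algebra.Polynomial"
begin

definition sup_norm :: "(real \<Rightarrow> real) \<Rightarrow> real" where
  "sup_norm f = (SUP x\<in>{0..1}. \<bar>f x\<bar>)"

definition poly_space :: "nat \<Rightarrow> real poly set" where
  "poly_space n = {p. degree p \<le> n}"

text \<open>Functions on \<open>[0,1]\<close> and on \<open>(0,\<infinity>)\<close> are total functions on the reals
  whose values elsewhere are never used.\<close>

definition modulus_of_uniform_continuity :: "(real \<Rightarrow> real) \<Rightarrow> (real \<Rightarrow> real) \<Rightarrow> bool" where
  "modulus_of_uniform_continuity \<omega> f \<longleftrightarrow>
     (\<forall>\<epsilon>>0. \<omega> \<epsilon> > 0 \<and>
        (\<forall>x\<in>{0..1}. \<forall>y\<in>{0..1}. \<bar>x - y\<bar> < \<omega> \<epsilon> \<longrightarrow> \<bar>f x - f y\<bar> < \<epsilon>))"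

definition chi :: "(real \<Rightarrow> real) \<Rightarrow> nat \<Rightarrow> real \<Rightarrow> real \<Rightarrow> real" where
  "chi \<omega> n M \<epsilon> = min 1 (min (\<epsilon> / (4 * real n ^ 2 * M + 1)) (\<omega> (\<epsilon> / 2)))"

definition F_const :: "nat \<Rightarrow> real" where
  "F_const n = 3 / 2 * Max ((\<lambda>i. (2 * real n ^ 2) ^ i / fact i) ` {0..n})"

text \<open>A finite sequence \<open>h\<^sub>1, \<dots>, h\<^bsub>r+1\<^esub>\<close> is a list, so that \<open>h ! i\<close> is
  \<open>h\<^bsub>i+1\<^esub>\<close> and \<open>length h\<close> is \<open>r + 1\<close>.\<close>

definition lambda_of :: "nat list \<Rightarrow> nat list" where
  "lambda_of h = map (\<lambda>i. h ! i + (i + 1) - length h) [0..<length h]"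

definition N_of :: "nat list \<Rightarrow> real" where
  "N_of l = (\<Prod>(i, j) | i < j \<and> j < length l.
     (real (l ! i) - real (l ! j) + real j - real i) / (real j - real i))"

definition decreasing_seqs :: "nat \<Rightarrow> nat list set" where
  "decreasing_seqs n =
     {h. h \<noteq> [] \<and> sorted_wrt (>) h \<and> length h \<le> n + 1 \<and> hd h \<le> n}"

definition N_const :: "nat \<Rightarrow> real" where
  "N_const n = Max ((\<lambda>h. N_of (lambda_of h)) ` decreasing_seqs n)"

text \<open>The truncated subtraction in \<open>lambda_of\<close> never truncates, and the maximum in
  \<open>N_const\<close> is taken over a finite nonempty set.\<close>

lemma lambda_of_no_truncation:
  assumes "sorted_wrt (>) (h :: nat list)" "i < length h"
  shows "length h \<le> h ! i + (i + 1)"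
  using assms
proof (induction h arbitrary: i)
  case Nil
  then show ?case by simp
next
  case (Cons a h)
  show ?case
  proof (cases i)
    case 0
    show ?thesis
    proof (cases h)
      case Nil
      then show ?thesis using 0 by simp
    next
      case (Cons b t)
      then have "b < a" using Cons.prems by simp
      moreover have "length h \<le> h ! 0 + 1" using Cons.IH[of 0] Cons.prems Cons by simp
      ultimately show ?thesis using 0 Cons by simp
    qed
  next
    case (Suc j)
    then show ?thesis using Cons.IH[of j] Cons.prems by simp
  qed
qed

lemma finite_decreasing_seqs: "finite (decreasing_seqs n)"
proof (rule finite_subset)
  show "decreasing_seqs n \<subseteq> {h. set h \<subseteq> {0..n} \<and> length h \<le> n + 1}"
  proof
    fix h assume h: "h \<in> decreasing_seqs n"
    then show "h \<in> {h. set h \<subseteq> {0..n} \<and> length h \<le> n + 1}"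
      by (cases h) (auto simp: decreasing_seqs_def dest!: bspec)
  qed
  show "finite {h. set h \<subseteq> {0..n} \<and> length h \<le> n + 1}"
    by (rule finite_lists_length_le) simp
qed

lemma decreasing_seqs_nonempty: "decreasing_seqs n \<noteq> {}"
proof -
  have "[0] \<in> decreasing_seqs n" by (simp add: decreasing_seqs_def)
  then show ?thesis by blast
qed

definition coeff_box ::
  "nat \<Rightarrow> nat \<Rightarrow> (nat \<Rightarrow> nat) \<Rightarrow> (nat \<Rightarrow> ereal) \<Rightarrow> (nat \<Rightarrow> ereal) \<Rightarrow> real poly set" where
  "coeff_box n m k a b =
     {p \<in> poly_space n. \<forall>i\<in>{1..m}. a i \<le> ereal (coeff p (k i)) \<and> ereal (coeff p (k i)) \<le> b i}"

end

theory Submission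
  imports Defs "Jordan_Normal_Form.Determinant"
begin

text \<open>
  \<open>K\<close> is convex, so a direction \<open>w\<close> with \<open>y + t w \<in> K\<close> for small \<open>t > 0\<close> cannot point towards
  \<open>f\<close> at all points where \<open>\<bar>f - y\<bar>\<close> is close to its maximum \<open>E\<close>.  Suppose that strong unicity
  fails for \<open>p \<in> K\<close>, put \<open>q = p - y\<close> and \<open>e = f - y\<close>.  Then \<open>q\<close> itself nearly is such a
  direction: \<open>sgn e * q > - \<gamma> \<parallel>q\<parallel>\<close> at all near-extremal points.  The proof corrects \<open>q\<close> by a small
  polynomial \<open>r\<close> so that \<open>sgn e * (q + r)\<close> is bounded below by a positive constant at all near-extremal
  points, which contradicts the optimality of \<open>y\<close> (\<open>small_step_decreases_error\<close>).

  The step towards \<open>q + r\<close> remains in \<open>K\<close> if no coefficient of \<open>r\<close>, except the constant one, exceeds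
  the corresponding coefficient of \<open>q\<close> (\<open>coeff_box_step\<close>).  Hence \<open>r\<close> is sought among the
  polynomials whose exponents lie in the set \<open>G\<close> consisting of \<open>0\<close> and of the exponents at which
  \<open>q\<close> has a coefficient above some threshold.  The correction is needed only on the set \<open>A\<close>
  of near-extremal points where \<open>sgn e * q\<close> is below another threshold.  Near-extremal points of
  opposite sign are at distance at least \<open>d = \<chi>(L / 2)\<close> because \<open>e\<close> has a known modulus of continuity
  (\<open>opposite_extrema_separated\<close>).  There are two cases (\<open>separated_points_or_cuts\<close>).

  If the sign of \<open>e\<close> changes fewer than \<open>card G\<close> times along \<open>A\<close>, a multiple of a polynomial with
  exponents in \<open>G\<close> and with zeros exactly at these changes serves as \<open>r\<close>
  (\<open>exists_sparse_poly_with_sign_changes\<close>).  Otherwise \<open>A\<close> contains \<open>card G + 1\<close> points with mutual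
  distances at least \<open>d\<close>.  There \<open>q\<close> is small, and so are its coefficients outside \<open>G\<close>, so
  that interpolation with exponents in \<open>G\<close> bounds \<open>\<parallel>q\<parallel>\<close> below its actual value
  (\<open>sparse_interpolation_bound\<close>), which is absurd.

  Both cases rest on a quantitative form of the fact that monomials with exponents in \<open>G\<close>
  form a Chebyshev system.  A generalized Vandermonde determinant is the ordinary one times a Schur
  polynomial (\<open>gvand_eq_vand_schur\<close>).  The latter has nonnegative coefficients with sum
  \<open>N\<^sub>\<lambda>\<close> (\<open>schur_ones\<close>); so on \<open>[0,1]\<close> it is at most \<open>N\<^sub>\<lambda>\<close>, and it is at least each of its monomials.
  This gives one factor \<open>N\<^sub>n\<close> and a power of \<open>d / 2\<close> for the lower bound of \<open>r\<close>, and another such factor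
  and a power of \<open>d\<close> for the interpolation.  The coefficients of \<open>r\<close> are controlled by a Markov inequality
  with the constant \<open>4 n\<^sup>2\<close>, twice the optimal one; the powers of \<open>2\<close> lost in this way are absorbed
  by the generous exponent of \<open>\<gamma>\<close> (\<open>exponent_bookkeeping\<close>).
\<close>

section \<open>Generalized Vandermonde determinants\<close>

definition gvand :: "nat \<Rightarrow> (nat \<Rightarrow> nat) \<Rightarrow> (nat \<Rightarrow> real) \<Rightarrow> real" where
  "gvand m g x = det (mat m m (\<lambda>(i, j). x i ^ g j))"

definition vand :: "nat \<Rightarrow> (nat \<Rightarrow> real) \<Rightarrow> real" where
  "vand m x = (\<Prod>j<m. \<Prod>i<j. x j - x i)"

text \<open>These functions are the rows of a Gelfand-Tsetlin pattern that can stand below the row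
  \<open>g\<close>: the sequence \<open>k\<close> interlaces \<open>g\<close>.\<close>
definition branch :: "nat \<Rightarrow> (nat \<Rightarrow> nat) \<Rightarrow> (nat \<Rightarrow> nat) set" where
  "branch m g = (\<Pi>\<^sub>E j\<in>{..<m}. {g j..<g (Suc j)})"

text \<open>The Schur polynomial of the partition \<open>g j - j\<close>, written through the branching rule that
  splits off the last variable.  In this form the nonnegativity of its coefficients is evident.\<close>
primrec schur :: "nat \<Rightarrow> (nat \<Rightarrow> nat) \<Rightarrow> (nat \<Rightarrow> real) \<Rightarrow> real" where
  "schur 0 g x = 1"
| "schur (Suc m) g x =
     (\<Sum>k\<in>branch m g. x m ^ (g 0 + (\<Sum>j<m. g (Suc j) - 1 - k j)) * schur m k x)"

lemma det_mat_columns: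
  fixes A :: "nat \<Rightarrow> nat \<Rightarrow> 'a::comm_ring_1"
  shows "det (mat m m (\<lambda>(i, j). A i j)) =
    (\<Sum>p | p permutes {0..<m}. signof p * (\<Prod>j<m. A (p j) j))"
proof -
  have perm: "p j < m" if "p permutes {0..<m}" "j < m" for p j
    using permutes_in_image[OF that(1), of j] that(2) by simp
  have "det (mat m m (\<lambda>(i, j). A i j)) =
    (\<Sum>p | p permutes {0..<m}. signof p * (\<Prod>j<m. mat m m (\<lambda>(i, j). A i j) $$ (p j, j)))"
    using det_col[of "mat m m (\<lambda>(i, j). A i j)" m] by (simp add: lessThan_atLeast0)
  also have "\<dots> = (\<Sum>p | p permutes {0..<m}. signof p * (\<Prod>j<m. A (p j) j))"
    by (intro sum.cong arg_cong2[where f = "(*)"] prod.cong refl) (simp add: perm)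
  finally show ?thesis .
qed

lemma det_sum_columns:
  fixes F :: "nat \<Rightarrow> nat \<Rightarrow> nat \<Rightarrow> 'a::comm_ring_1"
  assumes "\<And>j. j < m \<Longrightarrow> finite (S j)"
  shows "det (mat m m (\<lambda>(i, j). \<Sum>k\<in>S j. F i j k)) =
    (\<Sum>k\<in>(\<Pi>\<^sub>E j\<in>{..<m}. S j). det (mat m m (\<lambda>(i, j). F i j (k j))))"
proof -
  have "det (mat m m (\<lambda>(i, j). \<Sum>k\<in>S j. F i j k)) =
      (\<Sum>p | p permutes {0..<m}. \<Sum>k\<in>(\<Pi>\<^sub>E j\<in>{..<m}. S j).
      signof p * (\<Prod>j<m. F (p j) j (k j)))"
    unfolding det_mat_columns
    using assms by (intro sum.cong refl) (subst prod_sum_PiE, auto simp: sum_distrib_left)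
  also have "\<dots> = (\<Sum>k\<in>(\<Pi>\<^sub>E j\<in>{..<m}. S j). \<Sum>p | p permutes {0..<m}.
      signof p * (\<Prod>j<m. F (p j) j (k j)))"
    by (rule sum.swap)
  finally show ?thesis unfolding det_mat_columns .
qed

lemma det_scale_rows_columns:
  fixes A :: "nat \<Rightarrow> nat \<Rightarrow> 'a::comm_ring_1"
  shows "det (mat m m (\<lambda>(i, j). c i * (A i j * e j))) =
    (\<Prod>i<m. c i) * (\<Prod>j<m. e j) * det (mat m m (\<lambda>(i, j). A i j))"
proof -
  have "(\<Prod>j<m. c (p j)) = (\<Prod>i<m. c i)" if "p permutes {0..<m}" for p
    unfolding lessThan_atLeast0 by (rule prod.permute[OF that, of c, symmetric, unfolded comp_def])
  then show ?thesis
    unfolding det_mat_columns sum_distrib_left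
    by (intro sum.cong refl) (simp add: prod.distrib mult_ac)
qed

lemma power_diff_range:
  fixes x y :: real
  assumes "a \<le> b"
  shows "x ^ b - y ^ (b - a) * x ^ a = (x - y) * (\<Sum>k\<in>{a..<b}. x ^ k * y ^ (b - 1 - k))"
proof -
  have "(\<Sum>k\<in>{a..<b}. x ^ k * y ^ (b - 1 - k)) = (\<Sum>i<b - a. x ^ (i + a) * y ^ (b - 1 - (i + a)))"
    using assms by (subst sum.atLeastLessThan_shift_0) (simp add: lessThan_atLeast0 add.commute)
  also have "\<dots> = x ^ a * (\<Sum>i<b - a. y ^ ((b - a) - Suc i) * x ^ i)"
    unfolding sum_distrib_left
  proof (intro sum.cong refl)
    fix i
    have "b - 1 - (i + a) = b - a - Suc i" by simp
    then show "x ^ (i + a) * y ^ (b - 1 - (i + a)) = x ^ a * (y ^ (b - a - Suc i) * x ^ i)"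
      by (simp only: power_add mult_ac)
  qed
  finally have *: "(\<Sum>k\<in>{a..<b}. x ^ k * y ^ (b - 1 - k)) =
      x ^ a * (\<Sum>i<b - a. y ^ ((b - a) - Suc i) * x ^ i)" .
  have "x ^ b - y ^ (b - a) * x ^ a = x ^ a * (x ^ (b - a) - y ^ (b - a))"
    using assms by (simp add: right_diff_distrib power_add[symmetric] mult.commute)
  also have "x ^ (b - a) - y ^ (b - a) = (x - y) * (\<Sum>i<b - a. y ^ ((b - a) - Suc i) * x ^ i)"
    by (rule power_diff_sumr2)
  finally show ?thesis unfolding * by (simp add: mult_ac)
qed

text \<open>Column operations clear the last row, and each remaining entry is
  \<open>x i - x m\<close> times a sum of monomials whose exponents run through \<open>{g j..<g (Suc j)}\<close>.  Since these
  ranges are disjoint and increasing, expanding the columns produces generalized Vandermonde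
  determinants of the same kind in one variable less.\<close>
lemma gvand_branch:
  assumes mono: "\<And>j. j < m \<Longrightarrow> g j \<le> g (Suc j)"
  shows "gvand (Suc m) g x = (\<Prod>i<m. x m - x i) *
    (\<Sum>k\<in>branch m g. x m ^ (g 0 + (\<Sum>j<m. g (Suc j) - 1 - k j)) * gvand m k x)"
proof -
  define y where "y = x m"
  define A where "A = mat (Suc m) (Suc m) (\<lambda>(i, j). x i ^ g j)"
  \<comment> \<open>Multiplying by \<open>U\<close> subtracts a multiple of each column from the next one so
    that the last row is cleared except for its first entry.\<close>
  define U where "U = mat (Suc m) (Suc m) (\<lambda>(i, j). if i = j then 1
    else if Suc i = j then - (y ^ (g j - g i)) else (0::real))"
  define C where "C = mat (Suc m) (Suc m) (\<lambda>(i, j). if j = 0 then x i ^ g 0 else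
     (x i - y) * (\<Sum>k\<in>{g (j - 1)..<g j}. x i ^ k * y ^ (g j - 1 - k)))"
  have A: "A \<in> carrier_mat (Suc m) (Suc m)" and U: "U \<in> carrier_mat (Suc m) (Suc m)"
    and C: "C \<in> carrier_mat (Suc m) (Suc m)"
    by (simp_all add: A_def U_def C_def)
  have "upper_triangular U" by (auto simp: U_def)
  then have "det U = prod_list (diag_mat U)" using U by (rule det_upper_triangular)
  also have "diag_mat U = map (\<lambda>i. 1) [0..<Suc m]"
    unfolding diag_mat_def by (rule map_cong) (auto simp: U_def)
  finally have detU: "det U = 1" by (simp only: prod_list_replicate map_replicate_const) simp
  have "A * U = C"
  proof (rule eq_matI)
    fix i j assume ij: "i < dim_row C" "j < dim_col C"
    then have ij': "i < Suc m" "j < Suc m" by (auto simp: C_def)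
    have "(A * U) $$ (i, j) = (\<Sum>l<Suc m. x i ^ g l * U $$ (l, j))"
      using ij' by (simp add: A_def U_def scalar_prod_def lessThan_atLeast0)
    also have "\<dots> = (\<Sum>l<Suc m. (if l = j then x i ^ g j else 0) +
        (if Suc l = j then - (y ^ (g j - g l)) * x i ^ g l else 0))"
      using ij' by (intro sum.cong) (auto simp: U_def)
    also have "\<dots> = C $$ (i, j)"
    proof (cases j)
      case 0
      then show ?thesis using ij' by (simp add: C_def)
    next
      case (Suc j')
      then have "g j' \<le> g j" using mono[of j'] ij' by simp
      from power_diff_range[OF this, of "x i" y]
      show ?thesis using ij' Suc by (simp add: C_def sum.distrib)
    qed
    finally show "(A * U) $$ (i, j) = C $$ (i, j)" .
  qed (auto simp: A_def U_def C_def)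
  then have "det A = det C" using det_mult[OF A U] detU by simp
  also have "\<dots> = (\<Sum>j<Suc m. C $$ (m, j) * cofactor C m j)"
    by (rule laplace_expansion_row[OF C]) simp
  also have "\<dots> = C $$ (m, 0) * cofactor C m 0"
    by (subst sum.lessThan_Suc_shift) (simp add: C_def y_def)
  also have "\<dots> = y ^ g 0 * ((- 1) ^ m * det (mat_delete C m 0))"
    by (simp add: cofactor_def C_def y_def)
  also have "mat_delete C m 0 = mat m m (\<lambda>(i, j). (x i - y) *
      ((\<Sum>k\<in>{g j..<g (Suc j)}. x i ^ k * y ^ (g (Suc j) - 1 - k)) * 1))"
    by (rule eq_matI) (auto simp: mat_delete_def C_def)
  also have "det \<dots> = (\<Prod>i<m. x i - y) *
      det (mat m m (\<lambda>(i, j). \<Sum>k\<in>{g j..<g (Suc j)}. x i ^ k * y ^ (g (Suc j) - 1 - k)))"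
    by (subst det_scale_rows_columns) simp
  also have "det (mat m m (\<lambda>(i, j). \<Sum>k\<in>{g j..<g (Suc j)}. x i ^ k * y ^ (g (Suc j) - 1 - k))) =
      (\<Sum>k\<in>branch m g. det (mat m m (\<lambda>(i, j). x i ^ k j * y ^ (g (Suc j) - 1 - k j))))"
    unfolding branch_def by (rule det_sum_columns) simp
  also have "\<dots> = (\<Sum>k\<in>branch m g. y ^ (\<Sum>j<m. g (Suc j) - 1 - k j) * gvand m k x)"
  proof (rule sum.cong[OF refl])
    fix k
    show "det (mat m m (\<lambda>(i, j). x i ^ k j * y ^ (g (Suc j) - 1 - k j))) =
        y ^ (\<Sum>j<m. g (Suc j) - 1 - k j) * gvand m k x"
      using det_scale_rows_columns[of m "\<lambda>_. 1" "\<lambda>i j. x i ^ k j" "\<lambda>j. y ^ (g (Suc j) - 1 - k j)"]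
      by (simp add: gvand_def power_sum)
  qed
  also have "y ^ g 0 * ((- 1) ^ m * ((\<Prod>i<m. x i - y) * \<dots>)) = ((- 1) ^ m * (\<Prod>i<m. x i - y)) *
      (\<Sum>k\<in>branch m g. y ^ (g 0 + (\<Sum>j<m. g (Suc j) - 1 - k j)) * gvand m k x)"
    by (simp add: sum_distrib_left power_add mult_ac)
  also have "(- 1) ^ m * (\<Prod>i<m. x i - y) = (\<Prod>i<m. y - x i)"
    using prod.distrib[of "\<lambda>_. - 1" "\<lambda>i. x i - y" "{..<m}"] by simp
  finally show ?thesis by (simp add: A_def gvand_def y_def)
qed

lemma finite_branch: "finite (branch m g)"
  unfolding branch_def by (rule finite_PiE) auto

lemma branch_strict_mono:
  assumes "strict_mono_on {..<Suc m} g" "k \<in> branch m g"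
  shows "strict_mono_on {..<m} k"
proof (rule strict_mono_onI)
  fix i j assume ij: "i \<in> {..<m}" "j \<in> {..<m}" "i < j"
  have "k i < g (Suc i)" using assms(2) ij(1) by (auto simp: branch_def PiE_def Pi_def)
  also have "\<dots> \<le> g j"
    using ij strict_mono_on_leD[OF assms(1), of "Suc i" j] by simp
  also have "\<dots> \<le> k j" using assms(2) ij(2) by (auto simp: branch_def PiE_def Pi_def)
  finally show "k i < k j" .
qed

lemma vand_Suc: "vand (Suc m) x = vand m x * (\<Prod>i<m. x m - x i)"
  by (simp add: vand_def)

lemma vand_nonzero: "inj_on x {..<m} \<Longrightarrow> vand m x \<noteq> 0"
  unfolding vand_def inj_on_def by (force simp: prod_zero_iff)

lemma gvand_eq_vand_schur:
  assumes "strict_mono_on {..<m} g"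
  shows "gvand m g x = vand m x * schur m g x"
  using assms
proof (induction m arbitrary: g)
  case 0
  then show ?case by (simp add: gvand_def vand_def)
next
  case (Suc m)
  have "g j \<le> g (Suc j)" if "j < m" for j
    using strict_mono_onD[OF Suc.prems, of j "Suc j"] that by simp
  then show ?case
    by (simp add: gvand_branch vand_Suc sum_distrib_left mult_ac
        Suc.IH[OF branch_strict_mono[OF Suc.prems]] cong: sum.cong)
qed

lemma schur_nonneg:
  assumes "\<And>i. i < m \<Longrightarrow> 0 \<le> x i"
  shows "0 \<le> schur m g x"
  using assms by (induction m arbitrary: g) (simp_all add: sum_nonneg)

lemma schur_le_ones:
  assumes "\<And>i. i < m \<Longrightarrow> 0 \<le> x i \<and> x i \<le> 1"
  shows "schur m g x \<le> schur m g (\<lambda>_. 1)"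
  using assms
proof (induction m arbitrary: g)
  case (Suc m)
  show ?case
    unfolding schur.simps
  proof (intro sum_mono mult_mono)
    fix k
    show "schur m k x \<le> schur m k (\<lambda>_. 1)" using Suc.prems by (intro Suc.IH) simp
    show "x m ^ e \<le> 1 ^ e" for e using Suc.prems[of m] by (simp add: power_le_one)
    show "0 \<le> schur m k x" using Suc.prems by (intro schur_nonneg) simp
  qed simp
qed simp

lemma schur_cong:
  assumes "\<And>j. j < m \<Longrightarrow> g j = g' j"
  shows "schur m g x = schur m g' x"
proof (cases m)
  case (Suc l)
  have "branch l g = branch l g'"
    unfolding branch_def
  proof (rule PiE_cong)
    fix j assume "j \<in> {..<l}"
    then have "g j = g' j" "g (Suc j) = g' (Suc j)" using assms Suc by simp_all
    then show "{g j..<g (Suc j)} = {g' j..<g' (Suc j)}" by simp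
  qed
  moreover have "(\<Sum>j<l. g (Suc j) - 1 - k j) = (\<Sum>j<l. g' (Suc j) - 1 - k j)" for k
    using assms Suc by (intro sum.cong) simp_all
  ultimately show ?thesis
    using assms[of 0] Suc by simp
qed simp

lemma schur_id: "schur m (\<lambda>i. i) x = 1"
proof (induction m)
  case (Suc m)
  have "branch m (\<lambda>i. i) = {restrict (\<lambda>i. i) {..<m}}"
  proof -
    have "branch m (\<lambda>i. i) = (\<Pi>\<^sub>E j\<in>{..<m}. {restrict (\<lambda>i. i) {..<m} j})"
      unfolding branch_def by (rule PiE_cong) auto
    also have "\<dots> = {restrict (\<lambda>i. i) {..<m}}" by (rule PiE_singleton) (rule restrict_extensional)
    finally show ?thesis .
  qed
  moreover have "schur m (restrict (\<lambda>i. i) {..<m}) x = schur m (\<lambda>i. i) x"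
    by (rule schur_cong) simp
  ultimately show ?case using Suc by simp
qed simp

lemma top_branch:
  assumes "strict_mono_on {..<Suc m} g"
  shows "restrict (\<lambda>j. g (Suc j) - 1) {..<m} \<in> branch m g"
proof -
  have "g (Suc j) - 1 \<in> {g j..<g (Suc j)}" if "j < m" for j
    using strict_mono_onD[OF assms, of j "Suc j"] that by auto
  then show ?thesis unfolding branch_def by (intro restrict_PiE_iff[THEN iffD2]) auto
qed

text \<open>The interlacing sequence with the largest entries contributes no power of the last variable
  beyond \<open>g 0\<close>.  If \<open>g 0 = 0\<close>, the last variable may therefore be arbitrarily small without
  spoiling a lower bound.\<close>
lemma schur_top_branch_le:
  assumes "strict_mono_on {..<Suc m} g" "\<And>i. i \<le> m \<Longrightarrow> 0 \<le> x i"
  shows "x m ^ g 0 * schur m (\<lambda>j. g (Suc j) - 1) x \<le> schur (Suc m) g x"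
proof -
  let ?k = "restrict (\<lambda>j. g (Suc j) - 1) {..<m}"
  have "x m ^ g 0 * schur m (\<lambda>j. g (Suc j) - 1) x =
      x m ^ (g 0 + (\<Sum>j<m. g (Suc j) - 1 - ?k j)) * schur m ?k x"
    using schur_cong[of m ?k "\<lambda>j. g (Suc j) - 1" x] by simp
  also have "\<dots> \<le> schur (Suc m) g x"
    unfolding schur.simps
    by (rule member_le_sum[OF top_branch[OF assms(1)]])
      (use assms(2) in \<open>auto intro!: mult_nonneg_nonneg schur_nonneg finite_branch\<close>)
  finally show ?thesis .
qed

lemma schur_ge_power:
  assumes "strict_mono_on {..<m} g" "0 \<le> \<theta>" "\<And>i. i < m \<Longrightarrow> \<theta> \<le> x i"
  shows "\<theta> ^ (\<Sum>j<m. g j - j) \<le> schur m g x"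
  using assms
proof (induction m arbitrary: g)
  case (Suc m)
  let ?k = "\<lambda>j. g (Suc j) - 1"
  have pos: "0 \<le> x i" if "i \<le> m" for i
    using Suc.prems(2) Suc.prems(3)[of i] that by simp
  have "strict_mono_on {..<m} (restrict ?k {..<m})"
    using branch_strict_mono[OF Suc.prems(1) top_branch[OF Suc.prems(1)]] .
  then have k: "strict_mono_on {..<m} ?k" by (simp add: strict_mono_on_def)
  have "\<theta> ^ (\<Sum>j<Suc m. g j - j) = \<theta> ^ g 0 * \<theta> ^ (\<Sum>j<m. ?k j - j)"
    by (simp add: sum.lessThan_Suc_shift power_add del: sum.lessThan_Suc)
  also have "\<dots> \<le> x m ^ g 0 * schur m ?k x"
    using Suc.prems pos[of m] by (intro mult_mono power_mono Suc.IH k) auto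
  also have "\<dots> \<le> schur (Suc m) g x"
    by (rule schur_top_branch_le[OF Suc.prems(1) pos])
  finally show ?case .
qed simp

text \<open>A partition with \<open>m\<close> parts, each at most \<open>n - m\<close>, has size at most \<open>m (n - m)\<close>.\<close>
lemma gap_sum_le:
  assumes "strict_mono_on {..<m} (g :: nat \<Rightarrow> nat)" "\<And>j. j < m \<Longrightarrow> g j < n"
  shows "(\<Sum>j<m. g j - j) \<le> m * (n - m)"
proof -
  have "g j + (m - j) \<le> n" if "j < m" for j
  proof -
    have "g (m - 1) \<ge> g j + d" if "j + d = m - 1" for d
      using that
    proof (induction d arbitrary: j)
      case (Suc d)
      then have "Suc j < m" by linarith
      then have "g j < g (Suc j)" using strict_mono_onD[OF assms(1), of j "Suc j"] by simp
      moreover have "g (Suc j) + d \<le> g (m - 1)" using Suc by simp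
      ultimately show ?case by linarith
    qed simp
    from this[of "m - 1 - j"] show ?thesis using that assms(2)[of "m - 1"] by simp
  qed
  then have "(\<Sum>j<m. g j - j) \<le> (\<Sum>j<m. n - m)" by (intro sum_mono) fastforce
  then show ?thesis by simp
qed

text \<open>Here \<open>x m\<close> is the evaluation point of a polynomial with zeros \<open>x 0, \<dots>, x (m - 1)\<close>; only the
  zeros have to stay away from \<open>0\<close>.\<close>
lemma schur_ge:
  assumes "strict_mono_on {..<Suc m} g" "g 0 = 0" "\<And>j. j \<le> m \<Longrightarrow> g j \<le> n"
    and "0 \<le> \<theta>" "\<theta> \<le> 1" "\<And>i. i < m \<Longrightarrow> \<theta> \<le> x i" "0 \<le> x m"
  shows "\<theta> ^ (m * (n - m)) \<le> schur (Suc m) g x"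
proof -
  let ?k = "\<lambda>j. g (Suc j) - 1"
  have pos: "0 < g (Suc j)" if "j < m" for j
    using strict_mono_onD[OF assms(1), of 0 "Suc j"] that by simp
  have k: "strict_mono_on {..<m} ?k"
  proof (rule strict_mono_onI)
    fix i j assume "i \<in> {..<m}" "j \<in> {..<m}" "i < j"
    then show "?k i < ?k j" using strict_mono_onD[OF assms(1), of "Suc i" "Suc j"] pos[of i] by simp
  qed
  have "?k j < n" if "j < m" for j
    using assms(3)[of "Suc j"] pos[OF that] that by simp
  then have "\<theta> ^ (m * (n - m)) \<le> \<theta> ^ (\<Sum>j<m. ?k j - j)"
    using assms(4,5) by (intro power_decreasing gap_sum_le k)
  also have "\<dots> \<le> schur m ?k x" by (rule schur_ge_power[OF k assms(4,6)])
  also have "\<dots> \<le> schur (Suc m) g x"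
  proof -
    have "0 \<le> x i" if "i \<le> m" for i
      using assms(4,7) assms(6)[of i] that by (cases "i = m") auto
    then show ?thesis using schur_top_branch_le[OF assms(1), of x] assms(2) by simp
  qed
  finally show ?thesis .
qed

lemma gvand_geometric:
  "gvand m g (\<lambda>i. q ^ i) = gvand m (\<lambda>i. i) (\<lambda>j. q ^ g j)"
proof -
  have "(mat m m (\<lambda>(i, j). (q ^ i) ^ g j))\<^sup>T = mat m m (\<lambda>(i, j). (q ^ g i) ^ j)"
    by (rule eq_matI) (auto simp: power_mult[symmetric] mult.commute)
  then show ?thesis
    unfolding gvand_def
    using det_transpose[of "mat m m (\<lambda>(i, j). (q ^ i) ^ g j)" m] by simp
qed

lemma schur_geometric_continuous: "isCont (\<lambda>q. schur m g (\<lambda>i. q ^ i)) a"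
  by (induction m arbitrary: g) (auto intro!: continuous_intros)

lemma tendsto_power_diff_quotient:
  assumes "i < j"
  shows "((\<lambda>q::real. (q ^ a - q ^ b) / (q ^ j - q ^ i)) \<longlongrightarrow>
    (real a - real b) / (real j - real i)) (at 1)"
proof -
  have d: "((\<lambda>q::real. (q ^ a - q ^ b) / (q - 1)) \<longlongrightarrow> real a - real b) (at 1)" for a b
  proof -
    have "((\<lambda>q::real. q ^ a - q ^ b) has_field_derivative (real a - real b)) (at 1)"
      by (auto intro!: derivative_eq_intros)
    then show ?thesis by (simp add: has_field_derivative_iff)
  qed
  have "((\<lambda>q::real. ((q ^ a - q ^ b) / (q - 1)) / ((q ^ j - q ^ i) / (q - 1))) \<longlongrightarrow>
      (real a - real b) / (real j - real i)) (at 1)"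
    using assms by (intro tendsto_divide d) auto
  then show ?thesis
    by (rule Lim_transform_eventually) (simp add: eventually_at_filter)
qed

text \<open>At the points \<open>q ^ i\<close> the generalized Vandermonde matrix is the transpose of an ordinary
  one, so that the Schur polynomial is a quotient of two products of differences of powers of \<open>q\<close>.  The
  claim is the limit \<open>q \<rightarrow> 1\<close>, where numerator and denominator both vanish.\<close>
lemma schur_ones:
  assumes "strict_mono_on {..<m} g"
  shows "schur m g (\<lambda>_. 1) = (\<Prod>j<m. \<Prod>i<j. (real (g j) - real (g i)) / (real j - real i))"
proof -
  have eq: "schur m g (\<lambda>i. q ^ i) = (\<Prod>j<m. \<Prod>i<j. (q ^ g j - q ^ g i) / (q ^ j - q ^ i))"
    if "0 < q" "q \<noteq> 1" for q :: real
  proof -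
    have "inj_on (\<lambda>i. q ^ i) {..<m}" using that by (auto simp: inj_on_def power_inject_exp')
    from vand_nonzero[OF this] have nz: "vand m (\<lambda>i. q ^ i) \<noteq> 0" .
    have "vand m (\<lambda>i. q ^ i) * schur m g (\<lambda>i. q ^ i) = vand m (\<lambda>j. q ^ g j)"
      using gvand_eq_vand_schur[OF assms, of "\<lambda>i. q ^ i"] gvand_geometric[where m = m and g = g and q = q]
        gvand_eq_vand_schur[of m "\<lambda>i. i" "\<lambda>j. q ^ g j"] by (simp add: schur_id strict_mono_on_def)
    then have "schur m g (\<lambda>i. q ^ i) = vand m (\<lambda>j. q ^ g j) / vand m (\<lambda>i. q ^ i)"
      using nz by (simp add: field_simps)
    then show ?thesis by (simp add: vand_def prod_dividef)
  qed
  have "((\<lambda>q. schur m g (\<lambda>i. q ^ i)) \<longlongrightarrow> schur m g (\<lambda>i. 1 ^ i)) (at 1)"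
    using schur_geometric_continuous[where a = 1] unfolding isCont_def .
  moreover have "\<forall>\<^sub>F q in at 1. schur m g (\<lambda>i. q ^ i) =
      (\<Prod>j<m. \<Prod>i<j. (q ^ g j - q ^ g i) / (q ^ j - q ^ i))"
  proof -
    have "\<forall>\<^sub>F q::real in at 1. q \<in> {0<..} - {1}"
      by (rule eventually_at_in_open) auto
    then show ?thesis by eventually_elim (use eq in auto)
  qed
  ultimately have "((\<lambda>q. \<Prod>j<m. \<Prod>i<j. (q ^ g j - q ^ g i) / (q ^ j - q ^ i)) \<longlongrightarrow>
      schur m g (\<lambda>i. 1 ^ i)) (at 1)"
    by (rule Lim_transform_eventually)
  moreover have "((\<lambda>q. \<Prod>j<m. \<Prod>i<j. (q ^ g j - q ^ g i) / (q ^ j - q ^ i)) \<longlongrightarrow>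
      (\<Prod>j<m. \<Prod>i<j. (real (g j) - real (g i)) / (real j - real i))) (at (1::real))"
    by (intro tendsto_prod tendsto_power_diff_quotient) simp
  ultimately have "schur m g (\<lambda>i. 1 ^ i) =
      (\<Prod>j<m. \<Prod>i<j. (real (g j) - real (g i)) / (real j - real i))"
    by (rule tendsto_unique[rotated]) simp
  then show ?thesis by simp
qed

section \<open>Sparse polynomials with prescribed zeros\<close>

definition nth_elem :: "nat set \<Rightarrow> nat \<Rightarrow> nat" where
  "nth_elem G j = sorted_list_of_set G ! j"

lemma nth_elem_strict_mono:
  assumes "finite G"
  shows "strict_mono_on {..<card G} (nth_elem G)"
  using strict_sorted_list_of_set[of G] assms
  by (auto simp: strict_mono_on_def nth_elem_def sorted_wrt_iff_nth_less)

lemma nth_elem_image: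
  assumes "finite G"
  shows "nth_elem G ` {..<card G} = G"
  using assms nth_image[of "card G" "sorted_list_of_set G"]
  by (simp add: nth_elem_def lessThan_atLeast0)

lemma nth_elem_0:
  assumes "finite G" "0 \<in> G"
  shows "nth_elem G 0 = 0"
proof -
  obtain j where j: "j < card G" "nth_elem G j = 0"
    using nth_elem_image[OF assms(1)] assms(2) by (metis (no_types, lifting) imageE lessThan_iff)
  then show ?thesis
    using strict_mono_onD[OF nth_elem_strict_mono[OF assms(1)], of 0 j] by (cases "j = 0") auto
qed

text \<open>Lists of exponents are decreasing in the definition of \<open>N_of\<close>, but increasing
  in \<open>schur\<close>; the shift by \<open>\<lambda>\<close> cancels in the differences.\<close>
lemma schur_ones_eq_N_of:
  assumes "finite G"
  shows "schur (card G) (nth_elem G) (\<lambda>_. 1) = N_of (lambda_of (rev (sorted_list_of_set G)))"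
proof -
  define m where "m = card G"
  define h where "h = rev (sorted_list_of_set G)"
  have len: "length h = m" by (simp add: h_def m_def)
  have sorted: "sorted_wrt (>) h" unfolding h_def sorted_wrt_rev by simp
  have h: "h ! i = nth_elem G (m - Suc i)" if "i < m" for i
    using that by (simp add: h_def nth_elem_def rev_nth m_def)
  have lam: "real (lambda_of h ! i) = real (h ! i) + real (i + 1) - real m" if "i < m" for i
    using lambda_of_no_truncation[OF sorted, of i] that
    by (simp add: lambda_of_def len of_nat_diff del: of_nat_Suc)
  have "N_of (lambda_of h) = (\<Prod>(i, j) | i < j \<and> j < m.
      (real (nth_elem G (m - Suc i)) - real (nth_elem G (m - Suc j))) / (real j - real i))"
    unfolding N_of_def
  proof (rule prod.cong)
    fix p assume "p \<in> {(i, j). i < j \<and> j < m}"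
    then show "(case p of (i, j) \<Rightarrow> (real (lambda_of h ! i) - real (lambda_of h ! j) + real j - real i) /
        (real j - real i)) =
      (case p of (i, j) \<Rightarrow> (real (nth_elem G (m - Suc i)) - real (nth_elem G (m - Suc j))) / (real j - real i))"
      by (auto simp only: lam h mem_Collect_eq split: prod.splits) (simp add: lam h)
  qed (simp add: lambda_of_def len)
  also have "\<dots> = (\<Prod>(j, i)\<in>(SIGMA j:{..<m}. {..<j}).
      (real (nth_elem G j) - real (nth_elem G i)) / (real j - real i))"
    by (rule prod.reindex_bij_witness[where i = "\<lambda>(j, i). (m - Suc j, m - Suc i)"
          and j = "\<lambda>(i, j). (m - Suc i, m - Suc j)"]) (auto simp: of_nat_diff)
  also have "\<dots> = (\<Prod>j<m. \<Prod>i<j. (real (nth_elem G j) - real (nth_elem G i)) / (real j - real i))"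
    by (simp add: prod.Sigma)
  finally show ?thesis
    unfolding m_def h_def using schur_ones[OF nth_elem_strict_mono[OF assms]] by simp
qed

lemma schur_ones_le_N_const:
  assumes "G \<subseteq> {..n}" "G \<noteq> {}"
  shows "schur (card G) (nth_elem G) (\<lambda>_. 1) \<le> N_const n"
proof -
  have fin: "finite G" using assms(1) finite_subset by blast
  define h where "h = rev (sorted_list_of_set G)"
  have set: "set h = G" using fin by (simp add: h_def)
  then have ne: "h \<noteq> []" using assms(2) by auto
  have "hd h \<in> G" using hd_in_set[OF ne] set by simp
  moreover have "length h \<le> n + 1" using card_mono[OF _ assms(1)] by (simp add: h_def)
  moreover have "sorted_wrt (>) h" unfolding h_def sorted_wrt_rev by simp
  ultimately have "h \<in> decreasing_seqs n" using ne assms(1) by (auto simp: decreasing_seqs_def)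
  then show ?thesis
    unfolding N_const_def schur_ones_eq_N_of[OF fin] h_def[symmetric]
    by (intro Max_ge finite_imageI finite_decreasing_seqs imageI)
qed

lemma N_const_ge_1: "1 \<le> N_const n"
  using schur_ones_le_N_const[of "{0}" n] by (simp add: branch_def)

text \<open>The polynomial is a generalized Vandermonde determinant with the points of \<open>Z\<close> and
  a variable as its nodes, divided by the ordinary Vandermonde determinant of \<open>Z\<close>.  Expansion along the
  row of the variable shows its exponents, and the factorization shows its zeros; the remaining
  factor \<open>s\<close> is a Schur polynomial.\<close>
lemma exists_poly_with_support_and_roots:
  assumes "finite Z" "Z \<subseteq> {\<theta>..1}" "0 \<le> \<theta>" "\<theta> \<le> 1"
    and "G \<subseteq> {..n}" "0 \<in> G" "card G = Suc (card Z)"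
  obtains R s where "\<And>i. i \<notin> G \<Longrightarrow> coeff R i = 0"
    and "\<And>x. poly R x = (\<Prod>z\<in>Z. x - z) * s x"
    and "\<And>x. x \<in> {0..1} \<Longrightarrow> \<theta> ^ (card Z * (n - card Z)) \<le> s x \<and> s x \<le> N_const n"
proof -
  define m where "m = card Z"
  obtain z where z: "bij_betw z {..<m} Z"
    using ex_bij_betw_nat_finite[OF assms(1)] by (auto simp: m_def lessThan_atLeast0)
  have fin: "finite G" using assms(5) finite_subset by blast
  define g where "g = nth_elem G"
  have g: "strict_mono_on {..<Suc m} g" "g ` {..<Suc m} = G" "g 0 = 0"
    using nth_elem_strict_mono[OF fin] nth_elem_image[OF fin] nth_elem_0[OF fin assms(6)] assms(7)
    by (simp_all add: g_def m_def)
  have gn: "g j \<le> n" if "j \<le> m" for j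
    using g(2) assms(5) that by (auto simp: image_subset_iff)
  have z_range: "\<theta> \<le> z i \<and> z i \<le> 1" if "i < m" for i
    using z assms(2) that by (auto simp: bij_betw_def)
  \<comment> \<open>The variable occurs in the last row only, so the cofactors of this row are constants.\<close>
  define A where "A x = mat (Suc m) (Suc m) (\<lambda>(i, j). (z(m := x)) i ^ g j)" for x
  have del: "mat_delete (A x) m j = mat_delete (A 0) m j" if "j < Suc m" for x j
    by (rule eq_matI) (auto simp: mat_delete_def A_def)
  define R where "R = (\<Sum>j<Suc m. monom (cofactor (A 0) m j / vand m z) (g j))"
  define s where "s x = schur (Suc m) g (z(m := x))" for x
  have nz: "vand m z \<noteq> 0" using z by (intro vand_nonzero) (auto simp: bij_betw_def)
  show ?thesis
  proof
    show "coeff R i = 0" if "i \<notin> G" for i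
      using that g(2) by (auto simp: R_def coeff_sum intro!: sum.neutral)
  next
    fix x
    have A: "A x \<in> carrier_mat (Suc m) (Suc m)" by (simp add: A_def)
    have "poly R x = (\<Sum>j<Suc m. A x $$ (m, j) * cofactor (A x) m j) / vand m z"
      unfolding R_def poly_sum sum_divide_distrib
    proof (rule sum.cong)
      fix j assume "j \<in> {..<Suc m}"
      then show "poly (monom (cofactor (A 0) m j / vand m z) (g j)) x =
          A x $$ (m, j) * cofactor (A x) m j / vand m z"
        using del[of j x] by (simp add: poly_monom cofactor_def) (simp add: A_def)
    qed simp
    also have "(\<Sum>j<Suc m. A x $$ (m, j) * cofactor (A x) m j) = gvand (Suc m) g (z(m := x))"
      using laplace_expansion_row[OF A, of m] by (simp add: gvand_def A_def)
    also have "\<dots> = vand m (z(m := x)) * (\<Prod>i<m. x - z i) * s x"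
      by (simp add: gvand_eq_vand_schur[OF g(1)] vand_Suc s_def)
    also have "vand m (z(m := x)) = vand m z"
      unfolding vand_def by (intro prod.cong) auto
    also have "(\<Prod>i<m. x - z i) = (\<Prod>z\<in>Z. x - z)"
      by (rule prod.reindex_bij_betw[OF z])
    finally show "poly R x = (\<Prod>z\<in>Z. x - z) * s x" using nz by simp
  next
    fix x :: real assume x: "x \<in> {0..1}"
    have range: "0 \<le> (z(m := x)) i \<and> (z(m := x)) i \<le> 1" if "i < Suc m" for i
      using z_range[of i] x that assms(3) by auto
    have "\<theta> ^ (m * (n - m)) \<le> s x"
      unfolding s_def
      by (rule schur_ge[OF g(1,3) gn assms(3,4)]) (use z_range x in auto)
    moreover have "s x \<le> schur (Suc m) g (\<lambda>_. 1)"
      unfolding s_def by (rule schur_le_ones[OF range])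
    moreover have "\<dots> \<le> N_const n"
      using schur_ones_le_N_const[OF assms(5)] assms(6,7) by (auto simp: g_def m_def)
    ultimately show "\<theta> ^ (card Z * (n - card Z)) \<le> s x \<and> s x \<le> N_const n"
      by (simp add: m_def)
  qed
qed

text \<open>The coefficient vector lies in the kernel of a generalized Vandermonde matrix, whose
  determinant is nonzero because Schur polynomials are positive at positive points.\<close>
lemma sparse_poly_eq_0:
  assumes "finite G" "\<And>i. i \<notin> G \<Longrightarrow> coeff p i = 0"
    and "finite U" "card U = card G" "\<And>u. u \<in> U \<Longrightarrow> 0 < u \<and> poly p u = 0"
  shows "p = (0 :: real poly)"
proof (rule ccontr)
  assume "p \<noteq> 0"
  define m where "m = card G"
  obtain u where u: "bij_betw u {..<m} U"
    using ex_bij_betw_nat_finite[OF assms(3)] assms(4) by (auto simp: m_def lessThan_atLeast0)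
  define g where "g = nth_elem G"
  have g: "strict_mono_on {..<m} g" "g ` {..<m} = G"
    using nth_elem_strict_mono[OF assms(1)] nth_elem_image[OF assms(1)] by (simp_all add: g_def m_def)
  have inj: "inj_on g {..<m}" by (rule strict_mono_on_imp_inj_on[OF g(1)])
  have u_pos: "0 < u i \<and> poly p (u i) = 0" if "i < m" for i
    using u assms(5) that by (auto simp: bij_betw_def)
  have eval: "poly p x = (\<Sum>j<m. x ^ g j * coeff p (g j))" for x
  proof -
    have "poly p x = (\<Sum>i\<in>{..degree p} \<union> G. coeff p i * x ^ i)"
      unfolding poly_altdef using assms(1)
      by (intro sum.mono_neutral_left) (auto simp: coeff_eq_0)
    also have "\<dots> = (\<Sum>i\<in>G. coeff p i * x ^ i)"
      using assms(1,2) by (intro sum.mono_neutral_right) auto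
    also have "\<dots> = (\<Sum>j<m. x ^ g j * coeff p (g j))"
      using inj g(2) by (subst g(2)[symmetric], subst sum.reindex) (auto simp: mult.commute)
    finally show ?thesis .
  qed
  define A where "A = mat m m (\<lambda>(i, j). u i ^ g j)"
  define v where "v = vec m (\<lambda>j. coeff p (g j))"
  have A: "A \<in> carrier_mat m m" by (simp add: A_def)
  have "A *\<^sub>v v = 0\<^sub>v m"
  proof (rule eq_vecI)
    fix i assume i: "i < dim_vec (0\<^sub>v m :: real vec)"
    then have "(A *\<^sub>v v) $ i = poly p (u i)"
      by (simp add: A_def v_def eval scalar_prod_def lessThan_atLeast0)
    then show "(A *\<^sub>v v) $ i = 0\<^sub>v m $ i" using u_pos i by simp
  qed (simp add: A_def)
  moreover have "v \<noteq> 0\<^sub>v m"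
  proof
    assume v: "v = 0\<^sub>v m"
    have "coeff p (g j) = 0" if "j < m" for j
      using arg_cong[OF v, of "\<lambda>w. w $ j"] that by (simp add: v_def)
    then have "coeff p i = 0" for i using assms(2)[of i] g(2) by blast
    then show False using \<open>p \<noteq> 0\<close> by (auto simp: poly_eq_iff)
  qed
  ultimately have "det A = 0"
    using det_0_iff_vec_prod_zero[OF A] by (metis v_def vec_carrier)
  moreover have "det A = vand m u * schur m g u"
    using gvand_eq_vand_schur[OF g(1), of u] by (simp add: gvand_def A_def)
  moreover have "vand m u \<noteq> 0" using u by (intro vand_nonzero) (auto simp: bij_betw_def)
  moreover have "schur m g u > 0"
  proof (cases "m = 0")
    case False
    define \<theta> where "\<theta> = Min (u ` {..<m})"
    have "0 < \<theta>" unfolding \<theta>_def using u_pos False by (subst Min_gr_iff) auto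
    then have "0 < \<theta> ^ (\<Sum>j<m. g j - j)" by simp
    also have "\<dots> \<le> schur m g u"
      using \<open>0 < \<theta>\<close> by (intro schur_ge_power[OF g(1)]) (auto simp: \<theta>_def)
    finally show ?thesis .
  qed simp
  ultimately show False by simp
qed

lemma prod_ge_power:
  fixes f :: "'a \<Rightarrow> real"
  assumes "0 \<le> \<kappa>" "\<And>z. z \<in> Z \<Longrightarrow> \<kappa> \<le> f z"
  shows "\<kappa> ^ card Z \<le> (\<Prod>z\<in>Z. f z)"
  using prod_mono[of Z "\<lambda>_. \<kappa>" f] assms by simp

lemma prod_abs_diff_le_1:
  fixes x :: real
  assumes "Z \<subseteq> {\<theta>..1}" "0 \<le> \<theta>" "x \<in> {0..1}"
  shows "(\<Prod>z\<in>Z. \<bar>x - z\<bar>) \<le> 1"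
proof (rule prod_le_1)
  fix z assume "z \<in> Z"
  then have "\<theta> \<le> z" "z \<le> 1" using assms(1) by auto
  then show "0 \<le> \<bar>x - z\<bar> \<and> \<bar>x - z\<bar> \<le> 1" using assms(2,3) by auto
qed

lemma exponent_split:
  fixes r n :: nat
  assumes "r \<le> n"
  shows "r + r * (n - r) = r * (n + 1 - r)"
proof -
  have "n + 1 - r = Suc (n - r)" using assms by simp
  then show ?thesis by simp
qed

text \<open>Lagrange interpolation with exponents in \<open>G\<close>.  For each node \<open>u\<close> the basis polynomial
  vanishes at the other nodes and is a multiple of a polynomial \<open>R u\<close> bounded by
  \<open>N_const n\<close> on the unit interval; separation of the nodes bounds \<open>R u\<close> from below at \<open>u\<close>.\<close>
lemma sparse_interpolation_bound:
  fixes d B :: real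
  assumes G: "G \<subseteq> {..n}" "0 \<in> G" "card G = Suc r" and p: "\<And>i. i \<notin> G \<Longrightarrow> coeff p i = 0"
    and U: "finite U" "card U = Suc r" "U \<subseteq> {d..1}"
    and sep: "\<And>u v. u \<in> U \<Longrightarrow> v \<in> U \<Longrightarrow> u \<noteq> v \<Longrightarrow> d \<le> \<bar>u - v\<bar>"
    and d: "0 < d" "d \<le> 1"
    and bound: "\<And>u. u \<in> U \<Longrightarrow> \<bar>poly p u\<bar> \<le> B" and x: "x \<in> {0..1}"
  shows "\<bar>poly p x\<bar> \<le> real (n + 1) * N_const n * B / d ^ (r * (n + 1 - r))"
proof -
  have fin: "finite G" using G(1) finite_subset by blast
  have rn: "r \<le> n" using card_mono[OF _ G(1)] G(3) by simp
  define e where "e = r * (n + 1 - r)"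
  have "\<exists>R. (\<forall>i. i \<notin> G \<longrightarrow> coeff R i = 0) \<and> (\<forall>v\<in>U - {u}. poly R v = 0) \<and>
      d ^ e \<le> \<bar>poly R u\<bar> \<and> \<bar>poly R x\<bar> \<le> N_const n" if u: "u \<in> U" for u
  proof -
    define Z where "Z = U - {u}"
    have Z: "finite Z" "Z \<subseteq> {d..1}" "card Z = r" using U u by (auto simp: Z_def)
    obtain R s where R: "\<And>i. i \<notin> G \<Longrightarrow> coeff R i = 0"
      "\<And>x. poly R x = (\<Prod>z\<in>Z. x - z) * s x"
      "\<And>x. x \<in> {0..1} \<Longrightarrow> d ^ (card Z * (n - card Z)) \<le> s x \<and> s x \<le> N_const n"
      using exists_poly_with_support_and_roots[OF Z(1,2) _ d(2) G(1,2)] d(1) Z(3) G(3) by auto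
    have u01: "u \<in> {0..1}" using u U(3) d(1) by auto
    have "d ^ e = d ^ card Z * d ^ (card Z * (n - card Z))"
      unfolding e_def exponent_split[OF rn, symmetric] Z(3) by (simp add: power_add)
    also have "\<dots> \<le> (\<Prod>z\<in>Z. \<bar>u - z\<bar>) * s u"
      using R(3)[OF u01] d(1) by (intro mult_mono prod_ge_power sep prod_nonneg) (auto simp: Z_def u)
    also have "\<dots> \<le> \<bar>poly R u\<bar>"
      unfolding R(2) abs_mult abs_prod by (intro mult_left_mono prod_nonneg) auto
    finally have 1: "d ^ e \<le> \<bar>poly R u\<bar>" .
    have "0 \<le> s x" using R(3)[OF x] d(1) zero_le_power[of d "card Z * (n - card Z)"] by linarith
    then have "\<bar>poly R x\<bar> = (\<Prod>z\<in>Z. \<bar>x - z\<bar>) * s x"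
      unfolding R(2) abs_mult abs_prod by simp
    also have "\<dots> \<le> 1 * N_const n"
      using R(3)[OF x] d(1) \<open>0 \<le> s x\<close> prod_abs_diff_le_1[OF Z(2) _ x] by (intro mult_mono) auto
    finally have 2: "\<bar>poly R x\<bar> \<le> N_const n" by simp
    have "poly R v = 0" if "v \<in> U - {u}" for v
      unfolding R(2) using that Z(1) by (auto simp: Z_def prod_zero_iff)
    then show ?thesis using 1 2 R(1) by blast
  qed
  then have "\<exists>R. \<forall>u\<in>U. (\<forall>i. i \<notin> G \<longrightarrow> coeff (R u) i = 0) \<and> (\<forall>v\<in>U - {u}. poly (R u) v = 0) \<and>
      d ^ e \<le> \<bar>poly (R u) u\<bar> \<and> \<bar>poly (R u) x\<bar> \<le> N_const n"
    by (intro bchoice ballI)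
  then obtain R where "\<forall>u\<in>U. (\<forall>i. i \<notin> G \<longrightarrow> coeff (R u) i = 0) \<and> (\<forall>v\<in>U - {u}. poly (R u) v = 0) \<and>
      d ^ e \<le> \<bar>poly (R u) u\<bar> \<and> \<bar>poly (R u) x\<bar> \<le> N_const n" ..
  then have R: "\<And>u i. u \<in> U \<Longrightarrow> i \<notin> G \<Longrightarrow> coeff (R u) i = 0"
      "\<And>u v. u \<in> U \<Longrightarrow> v \<in> U \<Longrightarrow> v \<noteq> u \<Longrightarrow> poly (R u) v = 0"
      "\<And>u. u \<in> U \<Longrightarrow> d ^ e \<le> \<bar>poly (R u) u\<bar>" "\<And>u. u \<in> U \<Longrightarrow> \<bar>poly (R u) x\<bar> \<le> N_const n"
    by auto
  have de: "0 < d ^ e" using d(1) by simp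
  define L where "L = (\<Sum>u\<in>U. Polynomial.smult (poly p u / poly (R u) u) (R u))"
  have "p - L = 0"
  proof (rule sparse_poly_eq_0[OF fin _ U(1)])
    show "coeff (p - L) i = 0" if "i \<notin> G" for i
      using that R(1) p by (simp add: L_def coeff_sum)
    show "0 < v \<and> poly (p - L) v = 0" if v: "v \<in> U" for v
    proof
      have "poly L v = (\<Sum>u\<in>U. if u = v then poly p v else 0)"
        unfolding L_def poly_sum
      proof (rule sum.cong)
        fix u assume u: "u \<in> U"
        have "poly (R v) v \<noteq> 0" using R(3)[OF v] de by auto
        then show "poly (Polynomial.smult (poly p u / poly (R u) u) (R u)) v = (if u = v then poly p v else 0)"
          using R(2)[OF u v] by (cases "u = v") simp_all
      qed simp
      then show "poly (p - L) v = 0" using v U(1) by simp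
      show "0 < v" using v U(3) d(1) by auto
    qed
  qed (use U G in simp)
  then have "\<bar>poly p x\<bar> = \<bar>poly L x\<bar>" by simp
  also have "\<dots> = \<bar>\<Sum>u\<in>U. poly p u / poly (R u) u * poly (R u) x\<bar>"
    by (simp add: L_def poly_sum)
  also have "\<dots> \<le> (\<Sum>u\<in>U. B / d ^ e * N_const n)"
  proof (rule order_trans[OF sum_abs sum_mono])
    fix u assume u: "u \<in> U"
    show "\<bar>poly p u / poly (R u) u * poly (R u) x\<bar> \<le> B / d ^ e * N_const n"
      unfolding abs_mult abs_divide
      using bound[OF u] R(3)[OF u] R(4)[OF u] de by (intro mult_mono frac_le) auto
  qed
  also have "\<dots> = real (Suc r) * (N_const n * B / d ^ e)"
    using U(2) by simp
  also have "\<dots> \<le> real (n + 1) * (N_const n * B / d ^ e)"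
  proof (rule mult_right_mono)
    obtain u where "u \<in> U" using U(2) by fastforce
    then have "0 \<le> B" using bound by (meson abs_ge_zero order_trans)
    then show "0 \<le> N_const n * B / d ^ e" using N_const_ge_1[of n] de by simp
  qed (use rn in simp)
  finally show ?thesis by (simp add: e_def mult_ac)
qed

lemma prod_diff_sign:
  fixes x :: real
  assumes "finite Z"
  shows "(- 1) ^ card Z * (- 1) ^ card {z\<in>Z. z < x} * (\<Prod>z\<in>Z. x - z) = (\<Prod>z\<in>Z. \<bar>x - z\<bar>)"
  using assms
proof (induction Z rule: finite_induct)
  case (insert a Z)
  have *: "{z \<in> insert a Z. z < x} = (if a < x then insert a {z\<in>Z. z < x} else {z\<in>Z. z < x})" by auto
  show ?case
    unfolding prod.insert[OF insert.hyps] insert.IH[symmetric] *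
    using insert.hyps by (cases "a < x") (auto simp: algebra_simps)
qed simp

text \<open>A subset of \<open>G\<close> that contains \<open>0\<close> and has one element more than \<open>Z\<close> supplies the exponents.
  The factor \<open>(- 1) ^ card Z\<close> makes the polynomial positive to the left of all points of \<open>Z\<close>.\<close>
lemma exists_sparse_poly_with_sign_changes:
  assumes Z: "finite Z" "Z \<subseteq> {\<kappa>..1}" "0 \<le> \<kappa>" "\<kappa> \<le> 1"
    and G: "G \<subseteq> {..n}" "0 \<in> G" "card Z < card G"
  obtains R where "\<And>i. i \<notin> G \<Longrightarrow> coeff R i = 0" and "\<And>x. x \<in> {0..1} \<Longrightarrow> \<bar>poly R x\<bar> \<le> N_const n"
    and "\<And>x. x \<in> {0..1} \<Longrightarrow> \<forall>z\<in>Z. \<kappa> \<le> \<bar>x - z\<bar> \<Longrightarrow>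
      \<kappa> ^ (card Z * (n + 1 - card Z)) \<le> (- 1) ^ card {z\<in>Z. z < x} * poly R x"
proof -
  have fin: "finite G" using G(1) finite_subset by blast
  have "card Z \<le> card (G - {0})" using G by (simp add: fin)
  then obtain H' where H': "H' \<subseteq> G - {0}" "card H' = card Z"
    by (meson obtain_subset_with_card_n)
  \<comment> \<open>Keeping the exponent \<open>0\<close> prevents the polynomial from vanishing at \<open>0\<close>.\<close>
  define H where "H = insert 0 H'"
  have finH: "finite H'" using H' fin finite_subset by blast
  have H: "H \<subseteq> G" "0 \<in> H" "card H = Suc (card Z)"
    using H' G finH by (auto simp: H_def card_insert_if)
  have ln: "card Z \<le> n" using card_mono[OF _ order_trans[OF H(1) G(1)]] H(3) by simp
  obtain R s where R: "\<And>i. i \<notin> H \<Longrightarrow> coeff R i = 0"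
      "\<And>x. poly R x = (\<Prod>z\<in>Z. x - z) * s x"
      "\<And>x. x \<in> {0..1} \<Longrightarrow> \<kappa> ^ (card Z * (n - card Z)) \<le> s x \<and> s x \<le> N_const n"
    using exists_poly_with_support_and_roots[OF Z order_trans[OF H(1) G(1)] H(2,3)] by blast
  have s0: "0 \<le> s x" if "x \<in> {0..1}" for x
    using R(3)[OF that] Z(3) zero_le_power[of \<kappa> "card Z * (n - card Z)"] by linarith
  show ?thesis
  proof
    show "coeff (Polynomial.smult ((- 1) ^ card Z) R) i = 0" if "i \<notin> G" for i
      using R(1) H(1) that by auto
    show "\<bar>poly (Polynomial.smult ((- 1) ^ card Z) R) x\<bar> \<le> N_const n" if x: "x \<in> {0..1}" for x
    proof -
      have "\<bar>poly (Polynomial.smult ((- 1) ^ card Z) R) x\<bar> = (\<Prod>z\<in>Z. \<bar>x - z\<bar>) * s x"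
        using s0[OF x] by (simp add: R(2) abs_mult abs_prod power_abs)
      also have "\<dots> \<le> 1 * N_const n"
        using R(3)[OF x] s0[OF x] prod_abs_diff_le_1[OF Z(2,3) x] by (intro mult_mono) auto
      finally show ?thesis by simp
    qed
    show "\<kappa> ^ (card Z * (n + 1 - card Z)) \<le>
        (- 1) ^ card {z\<in>Z. z < x} * poly (Polynomial.smult ((- 1) ^ card Z) R) x"
      if x: "x \<in> {0..1}" and far: "\<forall>z\<in>Z. \<kappa> \<le> \<bar>x - z\<bar>" for x
    proof -
      have "\<kappa> ^ (card Z * (n + 1 - card Z)) = \<kappa> ^ card Z * \<kappa> ^ (card Z * (n - card Z))"
        unfolding exponent_split[OF ln, symmetric] by (simp add: power_add)
      also have "\<dots> \<le> (\<Prod>z\<in>Z. \<bar>x - z\<bar>) * s x"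
        using R(3)[OF x] Z(3) far by (intro mult_mono prod_ge_power prod_nonneg) auto
      also have "\<dots> = (- 1) ^ card {z\<in>Z. z < x} * poly (Polynomial.smult ((- 1) ^ card Z) R) x"
        unfolding prod_diff_sign[OF Z(1), symmetric] by (simp add: R(2) mult_ac)
      finally show ?thesis .
    qed
  qed
qed

section \<open>Markov-type inequalities on the unit interval\<close>

fun cheb :: "nat \<Rightarrow> real poly" where
  "cheb 0 = 1"
| "cheb (Suc 0) = [:0, 1:]"
| "cheb (Suc (Suc n)) = [:0, 2:] * cheb (Suc n) - cheb n"

lemma poly_cheb_cos: "poly (cheb n) (cos t) = cos (real n * t)"
proof (induction n rule: cheb.induct)
  case (3 n)
  have "cos (real (Suc (Suc n)) * t) + cos (real n * t) = 2 * cos t * cos (real (Suc n) * t)"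
    using cos_plus_cos[of "real (Suc (Suc n)) * t" "real n * t"]
    by (simp add: algebra_simps add_divide_distrib)
  then show ?case using 3 by simp
qed simp_all

lemma degree_cheb: "degree (cheb n) \<le> n"
proof (induction n rule: cheb.induct)
  case (3 n)
  have "degree ([:0, 2:] * cheb (Suc n)) \<le> Suc (Suc n)"
    using degree_mult_le[of "[:0, 2:]" "cheb (Suc n)"] 3 by simp
  then show ?case using 3 by (simp add: degree_diff_le)
qed simp_all

lemma cheb_at_1: "poly (cheb n) 1 = 1" "poly (pderiv (cheb n)) 1 = real n ^ 2"
proof (induction n rule: cheb.induct)
  case (3 n)
  case 1 then show ?case using 3 by simp
  case 2 then show ?case using 3
    by (simp add: pderiv_diff pderiv_mult pderiv_smult pderiv_pCons power2_eq_square algebra_simps)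
qed (simp_all add: pderiv_pCons)

lemma prod_roots_dvd:
  fixes p :: "'a::idom poly"
  assumes "finite Z" "\<And>z. z \<in> Z \<Longrightarrow> poly p z = 0"
  shows "(\<Prod>z\<in>Z. [:- z, 1:]) dvd p"
  using assms
proof (induction Z arbitrary: p rule: finite_induct)
  case (insert a Z)
  then have "[:- a, 1:] dvd p" by (simp add: poly_eq_0_iff_dvd)
  then obtain q where q: "p = [:- a, 1:] * q" by (rule dvdE)
  have "(\<Prod>z\<in>Z. [:- z, 1:]) dvd q"
  proof (rule insert.IH)
    fix z assume "z \<in> Z"
    then have "poly p z = 0" "z \<noteq> a" using insert by auto
    then show "poly q z = 0" by (simp add: q)
  qed
  then show ?case using insert.hyps by (simp add: q del: mult_pCons_left)
qed simp

text \<open>The Chebyshev polynomial alternates between \<open>1\<close> and \<open>- 1\<close> at \<open>n + 1\<close> points, so its difference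
  with \<open>p\<close> has all of its \<open>n\<close> zeros in \<open>(- 1, 1)\<close>, and it is positive at \<open>1\<close>.  Hence it is a product of
  factors that are increasing and positive at \<open>1\<close>, and its derivative is nonnegative there.\<close>
lemma Markov_endpoint_strict:
  assumes n: "0 < n" and deg: "degree p \<le> n" and bound: "\<And>x. x \<in> {-1..1} \<Longrightarrow> \<bar>poly p x\<bar> < 1"
  shows "poly (pderiv p) 1 \<le> real n ^ 2"
proof -
  define q where "q = cheb n - p"
  define c where "c j = cos (real j * pi / real n)" for j
  have c_less: "c (Suc j) < c j" if "j < n" for j
  proof -
    have "real (Suc j) * pi \<le> real n * pi" using that by (intro mult_right_mono) auto
    then show ?thesis unfolding c_def using n
      by (intro cos_monotone_0_pi) (auto simp: field_simps)
  qed
  have c_le: "c j \<le> c i" if "i \<le> j" "j \<le> n" for i j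
  proof -
    have "real j * pi \<le> real n * pi" "real i * pi \<le> real j * pi"
      using that by (auto intro!: mult_right_mono)
    then show ?thesis unfolding c_def using n
      by (intro cos_monotone_0_pi_le) (auto simp: divide_simps mult_ac)
  qed
  have c0: "c 0 = 1" by (simp add: c_def)
  have sign: "0 < (- 1) ^ j * poly q (c j)" for j
  proof -
    have "poly (cheb n) (c j) = (- 1) ^ j"
      using n by (simp add: c_def poly_cheb_cos mult.commute[of _ pi])
    moreover have "\<bar>poly p (c j)\<bar> < 1" by (rule bound) (simp add: c_def)
    ultimately show ?thesis
      by (cases "even j") (auto simp: q_def)
  qed
  have "\<exists>z. c (Suc j) < z \<and> z < c j \<and> poly q z = 0" if "j < n" for j
  proof -
    have "poly q (c (Suc j)) * poly q (c j) < 0"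
      using sign[of j] sign[of "Suc j"] by (cases "even j") (auto simp: mult_less_0_iff)
    from poly_IVT[OF c_less[OF that] this] show ?thesis by blast
  qed
  then obtain z where z: "\<And>j. j < n \<Longrightarrow> c (Suc j) < z j \<and> z j < c j \<and> poly q (z j) = 0"
    by metis
  have z_less: "z j < z i" if "i < j" "j < n" for i j
    using z[of i] z[of j] c_le[of "Suc i" j] that by force
  define Z where "Z = z ` {..<n}"
  have "inj_on z {..<n}"
    by (rule linorder_inj_onI') (use z_less in force)
  then have card: "card Z = n" by (simp add: Z_def card_image)
  have fin: "finite Z" by (simp add: Z_def)
  have Z: "poly q w = 0" "w < 1" if w: "w \<in> Z" for w
  proof -
    obtain j where "j < n" "w = z j" using w by (auto simp: Z_def)
    then show "poly q w = 0" "w < 1" using z[of j] c_le[of 0 j] c0 by auto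
  qed
  have q1: "0 < poly q 1" using sign[of 0] by (simp add: c_def)
  have degq: "degree q \<le> n" using degree_cheb[of n] deg by (simp add: q_def degree_diff_le)
  obtain h where h: "q = (\<Prod>w\<in>Z. [:- w, 1:]) * h"
    using prod_roots_dvd[OF fin, of q] Z(1) by (auto elim: dvdE)
  have "q \<noteq> 0" using q1 by auto
  then have "(\<Prod>w\<in>Z. [:- w, 1:]) \<noteq> 0" "h \<noteq> 0" using h by auto
  then have "degree q = degree (\<Prod>w\<in>Z. [:- w, 1:]) + degree h"
    unfolding h by (rule degree_mult_eq)
  also have "degree (\<Prod>w\<in>Z. [:- w, 1:]) = n"
    by (subst degree_prod_eq_sum_degree) (auto simp: card)
  finally have "degree h = 0" using degq by simp
  then obtain k where k: "h = [:k:]" by (rule degree_eq_zeroE)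
  have "poly q 1 = (\<Prod>w\<in>Z. 1 - w) * k" by (simp add: h k poly_prod)
  moreover have prod_pos: "0 < (\<Prod>w\<in>A. 1 - w)" if "A \<subseteq> Z" for A
    using Z(2) that by (intro prod_pos) auto
  ultimately have "0 < k" using q1 by (simp add: zero_less_mult_iff less_not_sym)
  have "poly (pderiv q) 1 = (\<Sum>w\<in>Z. \<Prod>w\<in>Z - {w}. 1 - w) * k"
    by (simp add: h k pderiv_smult pderiv_prod pderiv_pCons poly_sum poly_prod)
  moreover have "0 \<le> (\<Sum>w\<in>Z. \<Prod>w\<in>Z - {w}. 1 - w)"
    by (intro sum_nonneg less_imp_le prod_pos) auto
  ultimately have "0 \<le> poly (pderiv q) 1" using \<open>0 < k\<close> by simp
  then show ?thesis by (simp add: q_def pderiv_diff cheb_at_1)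
qed

lemma Markov_endpoint:
  assumes deg: "degree p \<le> n" and bound: "\<And>x. x \<in> {-1..1} \<Longrightarrow> \<bar>poly p x\<bar> \<le> B"
  shows "\<bar>poly (pderiv p) 1\<bar> \<le> real n ^ 2 * B"
proof (cases "n = 0")
  case True
  then have "pderiv p = 0" using deg by (simp add: pderiv_eq_0_iff)
  then show ?thesis using True by simp
next
  case False
  have B: "0 \<le> B" using bound[of 0] by simp
  have strict: "\<bar>poly (pderiv p) 1\<bar> \<le> real n ^ 2 * C" if "B < C" for C
  proof -
    have C: "0 < C" using B that by simp
    have "poly (pderiv (Polynomial.smult (s / C) p)) 1 \<le> real n ^ 2" if "s = 1 \<or> s = - 1" for s
    proof (rule Markov_endpoint_strict)
      show "degree (Polynomial.smult (s / C) p) \<le> n" using deg degree_smult_le order_trans by blast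
      show "\<bar>poly (Polynomial.smult (s / C) p) x\<bar> < 1" if "x \<in> {-1..1}" for x
        using bound[OF that] \<open>B < C\<close> C \<open>s = 1 \<or> s = - 1\<close> by (auto simp: abs_mult)
    qed (use False in simp)
    from this[of 1] this[of "- 1"] show ?thesis
      using C by (simp add: pderiv_smult pderiv_minus field_simps abs_le_iff)
  qed
  show ?thesis
  proof (rule ccontr)
    assume "\<not> ?thesis"
    then have *: "real n ^ 2 * B < \<bar>poly (pderiv p) 1\<bar>" by simp
    then have "B < \<bar>poly (pderiv p) 1\<bar> / real n ^ 2" using False by (simp add: field_simps)
    then obtain C where C: "B < C" "C < \<bar>poly (pderiv p) 1\<bar> / real n ^ 2" using dense by blast
    then have "real n ^ 2 * C < \<bar>poly (pderiv p) 1\<bar>" using False by (simp add: field_simps)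
    then show False using strict[OF C(1)] by simp
  qed
qed

text \<open>An interval of length at least \<open>1 / 2\<close> has \<open>x\<close> as an endpoint and lies within \<open>[0,1]\<close>; the
  endpoint inequality on it costs a factor \<open>2\<close> compared with the optimal constant, but
  takes the place of the inequality of Bernstein at interior points.\<close>
lemma Markov_unit_interval:
  assumes deg: "degree p \<le> n" and bound: "\<And>x. x \<in> {0..1} \<Longrightarrow> \<bar>poly p x\<bar> \<le> B" and x: "x \<in> {0..1}"
  shows "\<bar>poly (pderiv p) x\<bar> \<le> 4 * real n ^ 2 * B"
proof -
  \<comment> \<open>The endpoint of \<open>[0,1]\<close> that is farther from \<open>x\<close>.\<close>
  define w :: real where "w = (if x \<ge> 1 / 2 then 0 else 1)"
  define h where "h = (x - w) / 2"
  have w: "w \<in> {0..1}" "1 / 4 \<le> \<bar>h\<bar>" using x by (auto simp: w_def h_def abs_if field_simps)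
  have "\<bar>poly (pderiv (p \<circ>\<^sub>p [:w + h, h:])) 1\<bar> \<le> real n ^ 2 * B"
  proof (rule Markov_endpoint)
    show "degree (p \<circ>\<^sub>p [:w + h, h:]) \<le> n"
      using deg degree_pcompose_le[of p "[:w + h, h:]"] by (auto split: if_splits intro: order_trans)
    fix u :: real assume u: "u \<in> {-1..1}"
    have "w + h + u * h = (1 - u) / 2 * w + (1 + u) / 2 * x" by (simp add: h_def field_simps)
    also have "\<dots> \<in> {0..1}"
    proof -
      have "0 \<le> (1 - u) / 2 * w + (1 + u) / 2 * x"
        using u w(1) x by (intro add_nonneg_nonneg mult_nonneg_nonneg) auto
      moreover have "(1 - u) / 2 * w + (1 + u) / 2 * x \<le> (1 - u) / 2 * 1 + (1 + u) / 2 * 1"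
        using u w(1) x by (intro add_mono mult_left_mono) auto
      ultimately show ?thesis by (simp add: field_simps)
    qed
    finally show "\<bar>poly (p \<circ>\<^sub>p [:w + h, h:]) u\<bar> \<le> B"
      using bound[of "w + h + u * h"] by (simp add: poly_pcompose)
  qed
  also have "poly (pderiv (p \<circ>\<^sub>p [:w + h, h:])) 1 = poly (pderiv p) x * h"
    by (simp add: pderiv_pcompose poly_pcompose pderiv_pCons h_def)
  finally have *: "\<bar>poly (pderiv p) x\<bar> * \<bar>h\<bar> \<le> real n ^ 2 * B" by (simp add: abs_mult)
  have "\<bar>poly (pderiv p) x\<bar> * (1 / 4) \<le> \<bar>poly (pderiv p) x\<bar> * \<bar>h\<bar>"
    using w(2) by (intro mult_left_mono) auto
  with * show ?thesis by simp
qed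

lemma poly_Lipschitz:
  assumes "degree p \<le> n" "\<And>x. x \<in> {0..1} \<Longrightarrow> \<bar>poly p x\<bar> \<le> B" "x \<in> {0..1}" "x' \<in> {0..1}"
  shows "\<bar>poly p x - poly p x'\<bar> \<le> 4 * real n ^ 2 * B * \<bar>x - x'\<bar>"
proof -
  have *: "\<bar>poly p b - poly p a\<bar> \<le> 4 * real n ^ 2 * B * \<bar>b - a\<bar>"
    if ab: "a < b" "a \<in> {0..1}" "b \<in> {0..1}" for a b
  proof -
    obtain t where t: "a < t" "t < b" "poly p b - poly p a = (b - a) * poly (pderiv p) t"
      using poly_MVT[OF ab(1)] by blast
    have "\<bar>poly (pderiv p) t\<bar> \<le> 4 * real n ^ 2 * B"
      by (rule Markov_unit_interval[OF assms(1,2)]) (use t ab in auto)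
    then have "\<bar>b - a\<bar> * \<bar>poly (pderiv p) t\<bar> \<le> \<bar>b - a\<bar> * (4 * real n ^ 2 * B)"
      by (rule mult_left_mono) simp
    then show ?thesis by (simp add: t(3) abs_mult mult_ac)
  qed
  show ?thesis
    using *[of x x'] *[of x' x] assms(3,4)
    by (cases x x' rule: linorder_cases) (simp_all add: abs_minus_commute)
qed

lemma coeff_bound_power:
  assumes "degree p \<le> n" "\<And>x. x \<in> {0..1} \<Longrightarrow> \<bar>poly p x\<bar> \<le> B"
  shows "\<bar>coeff p i\<bar> \<le> (4 * real n ^ 2) ^ i / fact i * B"
proof -
  have "x \<in> {0..1} \<Longrightarrow> \<bar>poly ((pderiv ^^ i) p) x\<bar> \<le> (4 * real n ^ 2) ^ i * B" for x
  proof (induction i arbitrary: x)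
    case (Suc i)
    have "degree ((pderiv ^^ i) p) \<le> n" for i
      using assms(1) by (induction i) (auto simp: degree_pderiv)
    from Markov_unit_interval[OF this Suc.IH Suc.prems] show ?case by (simp add: mult_ac)
  qed (use assms in simp)
  from this[of 0] have "\<bar>coeff ((pderiv ^^ i) p) 0\<bar> \<le> (4 * real n ^ 2) ^ i * B"
    by (simp add: poly_0_coeff_0)
  moreover have "coeff ((pderiv ^^ i) p) 0 = fact i * coeff p i"
    by (simp add: coeff_higher_pderiv pochhammer_fact)
  ultimately show ?thesis by (simp add: abs_mult field_simps)
qed

text \<open>The factor \<open>2 ^ n\<close> compensates for the constant \<open>4 n\<^sup>2\<close> in place of \<open>2 n\<^sup>2\<close> when the Markov inequality is
  iterated.\<close>
lemma coeff_bound: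
  assumes "degree p \<le> n" "\<And>x. x \<in> {0..1} \<Longrightarrow> \<bar>poly p x\<bar> \<le> B" "i \<le> n"
  shows "\<bar>coeff p i\<bar> \<le> 2 ^ n * F_const n * B"
proof -
  have B: "0 \<le> B" using assms(2)[of 0] by simp
  have F: "(2 * real n ^ 2) ^ i / fact i \<le> F_const n"
  proof -
    have "(2 * real n ^ 2) ^ i / fact i \<le> Max ((\<lambda>i. (2 * real n ^ 2) ^ i / fact i) ` {0..n})"
      using assms(3) by (intro Max_ge) auto
    moreover have "0 \<le> (2 * real n ^ 2) ^ i / fact i" by simp
    ultimately show ?thesis unfolding F_const_def by linarith
  qed
  have "(4 * real n ^ 2) ^ i / fact i = 2 ^ i * ((2 * real n ^ 2) ^ i / fact i)"
    using power_mult_distrib[of 2 "2 * real n ^ 2" i] by simp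
  also have "\<dots> \<le> 2 ^ n * F_const n"
    using assms(3) F by (intro mult_mono power_increasing) auto
  finally have "(4 * real n ^ 2) ^ i / fact i * B \<le> 2 ^ n * F_const n * B"
    using B by (rule mult_right_mono)
  with coeff_bound_power[OF assms(1,2), of i] show ?thesis by linarith
qed

section \<open>Sign changes on a set of reals\<close>

text \<open>Walk along \<open>A\<close> from the left and stop at the infimum of the next points of opposite sign: either this
  happens \<open>N\<close> times, which leaves \<open>N + 1\<close> separated points, or the midpoints of the gaps cut \<open>A\<close> into
  pieces of constant sign.  The last hypothesis says that \<open>A\<close> begins with the sign \<open>\<epsilon>\<close>; it is phrased
  without reference to a least element, which \<open>A\<close> need not have.\<close>
lemma separated_points_or_cuts:
  fixes A :: "real set" and s :: "real \<Rightarrow> real" and d \<epsilon> :: real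
  assumes "A \<noteq> {}" "bdd_below A" "0 < d"
    and "\<And>x. x \<in> A \<Longrightarrow> s x = 1 \<or> s x = - 1"
    and "\<And>x x'. x \<in> A \<Longrightarrow> x' \<in> A \<Longrightarrow> s x \<noteq> s x' \<Longrightarrow> d \<le> \<bar>x - x'\<bar>"
    and "\<And>x. x \<in> A \<Longrightarrow> \<exists>x'\<in>A. x' \<le> x \<and> s x' = \<epsilon>"
  shows "(\<exists>U\<subseteq>A. finite U \<and> card U = Suc N \<and> (\<forall>u\<in>U. \<forall>v\<in>U. u \<noteq> v \<longrightarrow> d \<le> \<bar>u - v\<bar>)) \<or>
    (\<exists>Z. finite Z \<and> card Z < N \<and> (\<forall>z\<in>Z. (\<exists>x\<in>A. x < z) \<and> (\<exists>x\<in>A. z < x)) \<and>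
      (\<forall>x\<in>A. (\<forall>z\<in>Z. d / 2 \<le> \<bar>x - z\<bar>) \<and> s x = \<epsilon> * (- 1) ^ card {z\<in>Z. z < x}))"
    (is "?points A N \<or> ?cuts A N \<epsilon>")
  using assms
proof (induction N arbitrary: A \<epsilon>)
  case 0
  then obtain x where "x \<in> A" by blast
  then have "?points A 0" by (intro exI[of _ "{x}"]) auto
  then show ?case ..
next
  case (Suc N)
  note d = Suc.prems(3) and sgn = Suc.prems(4) and sep = Suc.prems(5) and start = Suc.prems(6)
  have \<epsilon>: "\<epsilon> = 1 \<or> \<epsilon> = - 1" using Suc.prems(1) start sgn by blast
  define B where "B = {x \<in> A. s x \<noteq> \<epsilon>}"
  show ?case
  proof (cases "B = {}")
    case True
    then have "?cuts A (Suc N) \<epsilon>" by (intro exI[of _ "{}"]) (auto simp: B_def)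
    then show ?thesis ..
  next
    case False
    have bddB: "bdd_below B" using Suc.prems(2) by (rule bdd_below_mono) (auto simp: B_def)
    define b where "b = Inf B"
    have b_le: "b \<le> x" if "x \<in> B" for x
      unfolding b_def using that bddB by (rule cInf_lower)
    have gap: "x + d \<le> b" if "x \<in> A" "s x = \<epsilon>" "\<And>x'. x' \<in> B \<Longrightarrow> x < x'" for x
      unfolding b_def
    proof (rule cInf_greatest[OF False])
      fix x' assume x': "x' \<in> B"
      have "d \<le> \<bar>x - x'\<bar>" using that x' by (intro sep) (auto simp: B_def)
      then show "x + d \<le> x'" using that(3)[OF x'] by simp
    qed
    have below: "s x = \<epsilon> \<and> x + d \<le> b" if "x \<in> A" "x < b" for x
    proof -
      have "s x = \<epsilon>" using that b_le[of x] by (force simp: B_def)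
      moreover have "x < x'" if "x' \<in> B" for x' using b_le[OF that] \<open>x < b\<close> by simp
      ultimately show ?thesis using gap[OF that(1)] by simp
    qed
    obtain x0 where x0: "x0 \<in> A" "x0 + d \<le> b"
    proof -
      have "Inf B < b + d" using d by (simp add: b_def)
      then obtain b' where b': "b' \<in> B" "b' < b + d"
        using cInf_lessD[OF False] by blast
      then obtain x' where x': "x' \<in> A" "x' \<le> b'" "s x' = \<epsilon>" using start by (auto simp: B_def)
      have "d \<le> \<bar>x' - b'\<bar>" using x' b' by (intro sep) (auto simp: B_def)
      then show thesis using that[OF x'(1)] below[OF x'(1)] x'(2) b'(2) by simp
    qed
    define A' where "A' = {x \<in> A. b \<le> x}"
    have BA: "B \<subseteq> A'" using b_le by (auto simp: A'_def B_def)
    have "?points A' N \<or> ?cuts A' N (- \<epsilon>)"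
    proof (rule Suc.IH)
      show "A' \<noteq> {}" using BA False by auto
      show "bdd_below A'" using Suc.prems(2) by (rule bdd_below_mono) (auto simp: A'_def)
      show "\<exists>x'\<in>A'. x' \<le> x \<and> s x' = - \<epsilon>" if x: "x \<in> A'" for x
      proof -
        have "\<exists>x'\<in>B. x' \<le> x"
        proof (cases "x \<in> B")
          case False
          show ?thesis
          proof (rule ccontr)
            assume "\<not> ?thesis"
            then have "x + d \<le> b" using x False by (intro gap) (auto simp: A'_def B_def not_le)
            then show False using x d by (simp add: A'_def)
          qed
        qed auto
        then obtain x' where x': "x' \<in> B" "x' \<le> x" by blast
        moreover have "s x' = - \<epsilon>" using x'(1) sgn[of x'] \<epsilon> by (auto simp: B_def)
        ultimately show ?thesis using BA by blast
      qed
    qed (use d sgn sep in \<open>auto simp: A'_def\<close>)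
    then show ?thesis
    proof
      assume "?points A' N"
      then obtain U where U: "U \<subseteq> A'" "finite U" "card U = Suc N"
        "\<forall>u\<in>U. \<forall>v\<in>U. u \<noteq> v \<longrightarrow> d \<le> \<bar>u - v\<bar>" by blast
      have far: "x0 + d \<le> u" if "u \<in> U" for u using that U(1) x0(2) by (auto simp: A'_def)
      have "x0 \<notin> U" using far[of x0] d by auto
      moreover have "d \<le> \<bar>u - x0\<bar>" "d \<le> \<bar>x0 - u\<bar>" if "u \<in> U" for u using far[OF that] by auto
      ultimately have "?points A (Suc N)"
        using U x0(1) by (intro exI[of _ "insert x0 U"]) (auto simp: A'_def)
      then show ?thesis ..
    next
      assume "?cuts A' N (- \<epsilon>)"
      then obtain Z where Z: "finite Z" "card Z < N"
        "\<And>z. z \<in> Z \<Longrightarrow> \<exists>x\<in>A'. x < z" "\<And>z. z \<in> Z \<Longrightarrow> \<exists>x\<in>A'. z < x"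
        "\<And>x z. x \<in> A' \<Longrightarrow> z \<in> Z \<Longrightarrow> d / 2 \<le> \<bar>x - z\<bar>"
        "\<And>x. x \<in> A' \<Longrightarrow> s x = - \<epsilon> * (- 1) ^ card {z\<in>Z. z < x}" by blast
      \<comment> \<open>The points of \<open>A\<close> before \<open>b\<close> are at most \<open>b - d\<close>, so the middle of this gap separates.\<close>
      define c where "c = b - d / 2"
      have bZ: "b < z" if "z \<in> Z" for z using Z(3)[OF that] by (auto simp: A'_def)
      have cZ: "c \<notin> Z" using bZ[of c] d by (auto simp: c_def)
      have "(\<forall>z\<in>insert c Z. d / 2 \<le> \<bar>x - z\<bar>) \<and> s x = \<epsilon> * (- 1) ^ card {z\<in>insert c Z. z < x}"
        if x: "x \<in> A" for x
      proof (cases "x < b")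
        case True
        note low = below[OF x True]
        have "{z\<in>insert c Z. z < x} = {}" using low True bZ d by (force simp: c_def)
        then have "s x = \<epsilon> * (- 1) ^ card {z\<in>insert c Z. z < x}"
          using low by (simp only: card.empty power_0 mult_1_right)
        moreover have "d / 2 \<le> \<bar>x - z\<bar>" if "z \<in> insert c Z" for z
          using that low bZ[of z] d by (auto simp: c_def)
        ultimately show ?thesis by blast
      next
        case False
        then have xA: "x \<in> A'" using x by (simp add: A'_def)
        have "{z\<in>insert c Z. z < x} = insert c {z\<in>Z. z < x}" using False d by (auto simp: c_def)
        moreover have "c \<notin> {z\<in>Z. z < x}" "finite {z\<in>Z. z < x}" using cZ Z(1) by auto
        ultimately have "card {z\<in>insert c Z. z < x} = Suc (card {z\<in>Z. z < x})" by simp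
        moreover have "d / 2 \<le> \<bar>x - z\<bar>" if "z \<in> insert c Z" for z
        proof (cases "z = c")
          case True
          then have "d / 2 \<le> x - z" using \<open>\<not> x < b\<close> by (simp add: c_def)
          then show ?thesis by linarith
        qed (use that Z(5)[OF xA] in auto)
        ultimately show ?thesis using Z(6)[OF xA] by simp
      qed
      moreover have "(\<exists>x\<in>A. x < z) \<and> (\<exists>x\<in>A. z < x)" if "z \<in> insert c Z" for z
      proof (cases "z = c")
        case True
        obtain b' where "b' \<in> B" using False by blast
        then have "b' \<in> A" "c < b'" using b_le[of b'] d by (auto simp: B_def c_def)
        moreover have "x0 < c" using x0(2) d by (simp add: c_def)
        ultimately show ?thesis using x0(1) True by blast
      next
        case False
        then show ?thesis using that Z(3,4)[of z] by (auto simp: A'_def)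
      qed
      ultimately have "?cuts A (Suc N) \<epsilon>"
        using Z(1,2) cZ by (intro exI[of _ "insert c Z"]) auto
      then show ?thesis ..
    qed
  qed
qed

text \<open>Points of \<open>A\<close> closer than \<open>d\<close> to its infimum all have the same sign.\<close>
lemma exists_initial_sign:
  fixes A :: "real set" and s :: "real \<Rightarrow> real"
  assumes "A \<noteq> {}" "bdd_below A" "0 < d"
    and "\<And>x x'. x \<in> A \<Longrightarrow> x' \<in> A \<Longrightarrow> s x \<noteq> s x' \<Longrightarrow> d \<le> \<bar>x - x'\<bar>"
  obtains a where "a \<in> A" "\<And>x. x \<in> A \<Longrightarrow> \<exists>x'\<in>A. x' \<le> x \<and> s x' = s a"
proof -
  have "Inf A < Inf A + d" using assms(3) by simp
  then obtain a where a: "a \<in> A" "a < Inf A + d" using cInf_lessD[OF assms(1)] by blast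
  show thesis
  proof (rule that[OF a(1)])
    fix x assume x: "x \<in> A"
    show "\<exists>x'\<in>A. x' \<le> x \<and> s x' = s a"
    proof (cases "a \<le> x")
      case True
      then show ?thesis using a(1) by blast
    next
      case False
      then have "\<bar>x - a\<bar> < d" using cInf_lower[OF x assms(2)] a(2) by simp
      then have "s x = s a" using assms(4)[OF x a(1)] by fastforce
      then show ?thesis using x by blast
    qed
  qed
qed

section \<open>Directions of descent\<close>

lemma sup_norm_le:
  assumes "\<And>x. x \<in> {0..1} \<Longrightarrow> \<bar>g x\<bar> \<le> B"
  shows "sup_norm g \<le> B"
  unfolding sup_norm_def by (rule cSUP_least) (use assms in auto)

lemma abs_le_sup_norm:
  assumes "continuous_on {0..1} g" "x \<in> {0..1}"
  shows "\<bar>g x\<bar> \<le> sup_norm g"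
proof -
  obtain t where "\<forall>y\<in>{0..1}. \<bar>g y\<bar> \<le> \<bar>g t\<bar>"
    using continuous_attains_sup[of "{0..1::real}" "\<lambda>x. \<bar>g x\<bar>"] assms(1)
    by (auto intro: continuous_on_rabs)
  then have "bdd_above ((\<lambda>x. \<bar>g x\<bar>) ` {0..1})" by (intro bdd_aboveI[of _ "\<bar>g t\<bar>"]) auto
  then show ?thesis unfolding sup_norm_def using assms(2) by (rule cSUP_upper[rotated])
qed

lemma modulus_imp_continuous:
  assumes "modulus_of_uniform_continuity \<omega> f"
  shows "continuous_on {0..1} f"
proof (rule uniformly_continuous_imp_continuous)
  show "uniformly_continuous_on {0..1} f"
    unfolding uniformly_continuous_on_def dist_real_def
    using assms unfolding modulus_of_uniform_continuity_def by blast
qed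

text \<open>Where \<open>\<bar>e\<bar>\<close> is within \<open>\<eta>\<close> of \<open>E\<close>, the step gains at least \<open>t c\<close>; elsewhere a step of size at most
  \<open>\<eta> / 2\<close> does no harm.  Working with near-extremal instead of extremal points makes this uniform
  without compactness.\<close>
lemma small_step_decreases_error:
  fixes e w :: "real \<Rightarrow> real"
  assumes e: "\<And>x. x \<in> {0..1} \<Longrightarrow> \<bar>e x\<bar> \<le> E" and w: "\<And>x. x \<in> {0..1} \<Longrightarrow> \<bar>w x\<bar> \<le> W"
    and \<eta>: "0 < \<eta>" "\<eta> < E" and c: "0 < c"
    and descent: "\<And>x. x \<in> {0..1} \<Longrightarrow> E - \<eta> \<le> \<bar>e x\<bar> \<Longrightarrow> c \<le> sgn (e x) * w x"
  obtains t where "0 < t" "t \<le> 1 / 2" "sup_norm (\<lambda>x. e x - t * w x) < E"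
proof -
  define t where "t = min (1 / 2) (\<eta> / (2 * (\<bar>W\<bar> + 1)))"
  have t: "0 < t" "t \<le> 1 / 2" using \<eta>(1) unfolding t_def by (simp, intro min.cobounded1)
  have "t * (\<bar>W\<bar> + 1) \<le> \<eta> / (2 * (\<bar>W\<bar> + 1)) * (\<bar>W\<bar> + 1)"
    by (rule mult_right_mono) (auto simp: t_def)
  also have "\<eta> / (2 * (\<bar>W\<bar> + 1)) * (\<bar>W\<bar> + 1) = \<eta> / 2" by (simp add: field_simps)
  finally have tW: "t * (\<bar>W\<bar> + 1) \<le> \<eta> / 2" .
  have tw: "\<bar>t * w x\<bar> \<le> \<eta> / 2" if "x \<in> {0..1}" for x
  proof -
    have "\<bar>t * w x\<bar> \<le> t * (\<bar>W\<bar> + 1)"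
      unfolding abs_mult using w[OF that] t(1) by (intro mult_mono) auto
    then show ?thesis using tW by linarith
  qed
  have "sup_norm (\<lambda>x. e x - t * w x) \<le> max (E - t * c) (E - \<eta> / 2)"
  proof (rule sup_norm_le)
    fix x :: real assume x: "x \<in> {0..1}"
    show "\<bar>e x - t * w x\<bar> \<le> max (E - t * c) (E - \<eta> / 2)"
    proof (cases "E - \<eta> \<le> \<bar>e x\<bar>")
      case False
      then show ?thesis using tw[OF x] by linarith
    next
      case True
      have "t * c \<le> t * (sgn (e x) * w x)" using descent[OF x True] t(1) by (intro mult_left_mono) auto
      then have "t * c \<le> (if e x > 0 then t * w x else - (t * w x))"
        using True \<eta>(2) by (auto simp: sgn_if split: if_splits)
      then show ?thesis using tw[OF x] e[OF x] True \<eta> by (auto simp: abs_if split: if_splits)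
    qed
  qed
  also have "\<dots> < E" using t(1) c \<eta>(1) by simp
  finally show thesis using that t by blast
qed

text \<open>The heart of the argument.  The scale \<open>\<tau>\<close> fixes both thresholds: a correction of size
  \<open>\<tau> * N_const n\<close> changes values by at most half of \<open>\<theta>v\<close> and coefficients by at most \<open>\<theta>c\<close>.  The hypothesis
  on \<open>\<delta>\<close> says that \<open>\<tau>\<close> is large enough for the correction to outweigh \<open>\<delta>\<close>, and the hypothesis on
  \<open>Q\<close> that it is small enough for \<open>q\<close> not to be below both thresholds too often.  The condition on
  the coefficients of \<open>w\<close> is what \<open>coeff_box_step\<close> asks for.\<close>
lemma exists_descent_direction:
  fixes n :: nat and e :: "real \<Rightarrow> real" and q :: "real poly" and E d Q \<delta> \<eta> \<tau> :: real
  defines "X \<equiv> {x \<in> {0..1}. E - \<eta> \<le> \<bar>e x\<bar>}" and "F \<equiv> 2 ^ n * F_const n"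
  assumes \<eta>: "\<eta> < E" and d: "0 < d" "d \<le> 1" and deg: "degree q \<le> n" and \<tau>: "0 < \<tau>"
    and least: "\<And>B. (\<And>x. x \<in> {0..1} \<Longrightarrow> \<bar>poly q x\<bar> \<le> B) \<Longrightarrow> Q \<le> B"
    and sep: "\<And>x x'. x \<in> X \<Longrightarrow> x' \<in> X \<Longrightarrow> sgn (e x) \<noteq> sgn (e x') \<Longrightarrow> d \<le> \<bar>x - x'\<bar>"
    and lower: "\<And>x. x \<in> X \<Longrightarrow> - \<delta> \<le> sgn (e x) * poly q x"
    and \<delta>: "\<And>l. l \<le> n \<Longrightarrow> \<delta> < \<tau> * (d / 2) ^ (l * (n + 1 - l))"
    and Q: "\<And>r. r \<le> n \<Longrightarrow> real (n + 1) * N_const n * (2 * \<tau> * N_const n + real n * (\<tau> * F * N_const n)) /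
        d ^ (r * (n + 1 - r)) + real n * (\<tau> * F * N_const n) < Q"
  obtains w c where "0 < c" "degree w \<le> n"
    "\<And>i. 0 < i \<Longrightarrow> \<bar>coeff w i - coeff q i\<bar> \<le> \<bar>coeff q i\<bar>"
    "\<And>x. x \<in> X \<Longrightarrow> c \<le> sgn (e x) * poly w x"
proof -
  note N = N_const_ge_1[of n]
  define \<theta>v where "\<theta>v = 2 * \<tau> * N_const n"
  define \<theta>c where "\<theta>c = \<tau> * F * N_const n"
  define I where "I = {i \<in> {1..n}. \<bar>coeff q i\<bar> < \<theta>c}"
  define G where "G = {..n} - I"
  have G: "G \<subseteq> {..n}" "0 \<in> G" by (auto simp: G_def I_def)
  have finG: "finite G" using G(1) finite_subset by blast
  have \<theta>v: "0 < \<theta>v" using \<tau> N by (simp add: \<theta>v_def)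
  have X01: "x \<in> {0..1}" if "x \<in> X" for x using that by (simp add: X_def)
  have sgn: "sgn (e x) = 1 \<or> sgn (e x) = - 1" if "x \<in> X" for x
    using that \<eta> by (auto simp: X_def sgn_if)
  define A where "A = {x \<in> X. sgn (e x) * poly q x < \<theta>v}"
  have AX: "A \<subseteq> X" by (auto simp: A_def)
  show thesis
  proof (cases "A = {}")
    case True
    have "\<theta>v \<le> sgn (e x) * poly q x" if "x \<in> X" for x
      using True that unfolding A_def by (auto simp: not_less)
    then show thesis using that[OF \<theta>v deg] by simp
  next
    case False
    have bdd: "bdd_below A" using AX X01 by (intro bdd_belowI[of _ 0]) auto
    have sepA: "d \<le> \<bar>x - x'\<bar>" if "x \<in> A" "x' \<in> A" "sgn (e x) \<noteq> sgn (e x')" for x x'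
      using that AX by (intro sep) auto
    obtain a where a: "a \<in> A" "\<And>x. x \<in> A \<Longrightarrow> \<exists>x'\<in>A. x' \<le> x \<and> sgn (e x') = sgn (e a)"
      using exists_initial_sign[OF False bdd d(1), of "\<lambda>x. sgn (e x)"] sepA by blast
    define \<epsilon> where "\<epsilon> = sgn (e a)"
    have \<epsilon>: "\<epsilon> * \<epsilon> = 1" using sgn[of a] a(1) AX by (auto simp: \<epsilon>_def)
    have sgnA: "sgn (e x) = 1 \<or> sgn (e x) = - 1" if "x \<in> A" for x using sgn AX that by blast
    have "(\<exists>U\<subseteq>A. finite U \<and> card U = Suc (card G) \<and> (\<forall>u\<in>U. \<forall>v\<in>U. u \<noteq> v \<longrightarrow> d \<le> \<bar>u - v\<bar>)) \<or>
      (\<exists>Z. finite Z \<and> card Z < card G \<and> (\<forall>z\<in>Z. (\<exists>x\<in>A. x < z) \<and> (\<exists>x\<in>A. z < x)) \<and>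
        (\<forall>x\<in>A. (\<forall>z\<in>Z. d / 2 \<le> \<bar>x - z\<bar>) \<and> sgn (e x) = \<epsilon> * (- 1) ^ card {z\<in>Z. z < x}))"
      by (rule separated_points_or_cuts[OF False bdd d(1) sgnA sepA a(2)[folded \<epsilon>_def]])
    then consider (points) U where "U \<subseteq> A" "finite U" "card U = Suc (card G)"
        "\<forall>u\<in>U. \<forall>v\<in>U. u \<noteq> v \<longrightarrow> d \<le> \<bar>u - v\<bar>"
      | (cuts) Z where "finite Z" "card Z < card G" "\<forall>z\<in>Z. (\<exists>x\<in>A. x < z) \<and> (\<exists>x\<in>A. z < x)"
        "\<forall>x\<in>A. (\<forall>z\<in>Z. d / 2 \<le> \<bar>x - z\<bar>) \<and> sgn (e x) = \<epsilon> * (- 1) ^ card {z\<in>Z. z < x}"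
      by (elim disjE exE conjE) 
    then show thesis
    proof cases
      case points
      \<comment> \<open>Discarding the small coefficients of \<open>q\<close> makes sparse interpolation applicable.\<close>
      define g where "g = (\<Sum>i\<in>G. monom (coeff q i) i)"
      have g_supp: "coeff g i = 0" if "i \<notin> G" for i
        using that by (auto simp: g_def coeff_sum intro!: sum.neutral)
      have \<theta>c: "0 \<le> real n * \<theta>c"
        using \<tau> N by (auto simp: \<theta>c_def F_def F_const_def intro!: mult_nonneg_nonneg Max_ge_iff[THEN iffD2])
      have close: "\<bar>poly q x - poly g x\<bar> \<le> real n * \<theta>c" if x: "x \<in> {0..1}" for x
      proof -
        have "poly q x = (\<Sum>i\<le>n. coeff q i * x ^ i)"
          unfolding poly_altdef using deg by (intro sum.mono_neutral_left) (auto simp: coeff_eq_0)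
        also have "{..n} = G \<union> I" by (auto simp: G_def I_def)
        also have "(\<Sum>i\<in>G \<union> I. coeff q i * x ^ i) = poly g x + (\<Sum>i\<in>I. coeff q i * x ^ i)"
          using finG by (subst sum.union_disjoint) (auto simp: G_def I_def g_def poly_sum poly_monom)
        finally have "\<bar>poly q x - poly g x\<bar> \<le> (\<Sum>i\<in>I. \<bar>coeff q i * x ^ i\<bar>)" by simp
        also have "\<dots> \<le> (\<Sum>i\<in>I. \<theta>c)"
        proof (rule sum_mono)
          fix i assume "i \<in> I"
          then have "\<bar>coeff q i\<bar> * \<bar>x ^ i\<bar> \<le> \<theta>c * 1"
            using x by (intro mult_mono) (auto simp: I_def power_le_one)
          then show "\<bar>coeff q i * x ^ i\<bar> \<le> \<theta>c" by (simp add: abs_mult)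
        qed
        also have "\<dots> = real (card I) * \<theta>c" by simp
        also have "\<dots> \<le> real n * \<theta>c"
        proof (cases "I = {}")
          case False
          then have "0 \<le> \<theta>c" by (auto simp: I_def)
          moreover have "I \<subseteq> {1..n}" by (auto simp: I_def)
          then have "card I \<le> n" using card_mono[of "{1..n}" I] by simp
          ultimately show ?thesis by (intro mult_right_mono) auto
        qed (use \<theta>c in simp)
        finally show ?thesis .
      qed
      obtain r where r: "card G = Suc r" using G(2) finG by (metis card_Suc_Diff1)
      have rn: "r \<le> n" using card_mono[OF _ G(1)] r by simp
      \<comment> \<open>The least point may be close to \<open>0\<close>, where the interpolation bound degenerates; the others are at least \<open>d\<close>.\<close>
      define U' where "U' = U - {Min U}"
      have Une: "U \<noteq> {}" using points(3) by auto
      have U01: "u \<in> {0..1}" if "u \<in> U" for u using points(1) that AX X01 by blast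
      have U': "finite U'" "card U' = Suc r"
        using points(2,3) r Min_in[OF points(2) Une] by (simp_all add: U'_def)
      have "U' \<subseteq> {d..1}"
      proof
        fix u assume u: "u \<in> U'"
        then have "d \<le> \<bar>u - Min U\<bar>" "Min U \<le> u" "0 \<le> Min U"
          using points(2,4) Min_in[OF points(2) Une] U01[of "Min U"] by (auto simp: U'_def)
        then show "u \<in> {d..1}" using U01[of u] u by (auto simp: U'_def)
      qed
      moreover have "\<bar>poly g u\<bar> \<le> \<theta>v + real n * \<theta>c" if u: "u \<in> U'" for u
      proof -
        have uA: "u \<in> A" using u points(1) by (auto simp: U'_def)
        have "\<delta> \<le> \<tau>" using \<delta>[of 0] by simp
        also have "\<dots> \<le> \<theta>v" using \<tau> N by (simp add: \<theta>v_def)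
        finally have "\<bar>poly q u\<bar> \<le> \<theta>v"
          using lower[of u] uA sgnA[OF uA] AX by (auto simp: A_def)
        moreover have "u \<in> {0..1}" using uA AX X01 by blast
        ultimately show ?thesis using close[of u] by linarith
      qed
      ultimately have "\<bar>poly g x\<bar> \<le> real (n + 1) * N_const n * (\<theta>v + real n * \<theta>c) / d ^ (r * (n + 1 - r))"
        if "x \<in> {0..1}" for x
        using points(4) that
        by (intro sparse_interpolation_bound[OF G r g_supp U' _ _ d]) (auto simp: U'_def)
      then have "\<bar>poly q x\<bar> \<le> real (n + 1) * N_const n * (\<theta>v + real n * \<theta>c) / d ^ (r * (n + 1 - r)) + real n * \<theta>c"
        if "x \<in> {0..1}" for x
        using that close[OF that] by fastforce
      from least[OF this] have False using Q[OF rn] unfolding \<theta>v_def \<theta>c_def by linarith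
      then show thesis ..
    next
      case cuts
      have ZI: "Z \<subseteq> {d / 2..1}"
      proof
        fix z assume z: "z \<in> Z"
        obtain x x' where x: "x \<in> A" "x < z" "x' \<in> A" "z < x'" using cuts(3) z by blast
        then have "0 \<le> x" "x' \<le> 1" using AX X01[of x] X01[of x'] by auto
        then show "z \<in> {d / 2..1}" using x cuts(4) x(1) z by fastforce
      qed
      obtain R where R: "\<And>i. i \<notin> G \<Longrightarrow> coeff R i = 0" "\<And>x. x \<in> {0..1} \<Longrightarrow> \<bar>poly R x\<bar> \<le> N_const n"
        "\<And>x. x \<in> {0..1} \<Longrightarrow> \<forall>z\<in>Z. d / 2 \<le> \<bar>x - z\<bar> \<Longrightarrow>
          (d / 2) ^ (card Z * (n + 1 - card Z)) \<le> (- 1) ^ card {z\<in>Z. z < x} * poly R x"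
        using exists_sparse_poly_with_sign_changes[OF cuts(1) ZI _ _ G cuts(2)] d by auto
      define \<rho> where "\<rho> = (d / 2) ^ (card Z * (n + 1 - card Z))"
      have Zn: "card Z \<le> n" using cuts(2) card_mono[OF _ G(1)] by simp
      have degR: "degree R \<le> n"
        by (intro degree_le allI impI R(1)) (use G(1) in auto)
      \<comment> \<open>The sign \<open>\<epsilon>\<close> is that of \<open>e\<close> on the leftmost piece of \<open>A\<close>, where \<open>R\<close> is positive.\<close>
      define w where "w = q + Polynomial.smult (\<epsilon> * \<tau>) R"
      define c where "c = min (\<tau> * \<rho> - \<delta>) (\<tau> * N_const n)"
      have abs_\<epsilon>: "\<bar>\<epsilon>\<bar> = 1" using sgn[of a] a(1) AX by (auto simp: \<epsilon>_def)
      show thesis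
      proof (rule that)
        show "0 < c" using \<delta>[OF Zn] \<tau> N by (simp add: c_def \<rho>_def)
        show "degree w \<le> n"
          unfolding w_def using deg degR by (intro degree_add_le) (auto intro: order_trans[OF degree_smult_le])
        show "\<bar>coeff w i - coeff q i\<bar> \<le> \<bar>coeff q i\<bar>" if i: "0 < i" for i
        proof (cases "i \<in> G")
          case True
          have "\<bar>coeff w i - coeff q i\<bar> = \<tau> * \<bar>coeff R i\<bar>"
            using \<tau> abs_\<epsilon> by (simp add: w_def abs_mult)
          also have "\<dots> \<le> \<tau> * (F * N_const n)"
            unfolding F_def using \<tau> True G(1)
            by (intro mult_left_mono coeff_bound[OF degR R(2)]) auto
          also have "\<dots> = \<theta>c" by (simp add: \<theta>c_def)
          also have "\<theta>c \<le> \<bar>coeff q i\<bar>" using True i by (auto simp: G_def I_def)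
          finally show ?thesis .
        qed (simp add: w_def R(1))
        show "c \<le> sgn (e x) * poly w x" if x: "x \<in> X" for x
        proof (cases "x \<in> A")
          case True
          have "sgn (e x) * poly w x = sgn (e x) * poly q x +
              (\<epsilon> * \<epsilon>) * (\<tau> * ((- 1) ^ card {z\<in>Z. z < x} * poly R x))"
            unfolding w_def poly_add poly_smult distrib_left by (simp add: cuts(4)[rule_format, OF True, THEN conjunct2] mult_ac)
          moreover have "\<tau> * \<rho> \<le> \<tau> * ((- 1) ^ card {z\<in>Z. z < x} * poly R x)"
            unfolding \<rho>_def using \<tau> cuts(4) True R(3)[OF X01[OF x]] by (intro mult_left_mono) auto
          ultimately show ?thesis using lower[OF x] unfolding \<epsilon> c_def by linarith
        next
          case False
          have "\<bar>\<epsilon> * \<tau> * poly R x\<bar> \<le> \<tau> * N_const n"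
            using \<tau> R(2)[OF X01[OF x]] by (simp add: abs_mult abs_\<epsilon>)
          moreover have "\<theta>v \<le> sgn (e x) * poly q x" using False x by (auto simp: A_def)
          ultimately have "\<tau> * N_const n \<le> sgn (e x) * poly w x"
            using sgn[OF x] by (auto simp: w_def \<theta>v_def)
          then show ?thesis by (simp add: c_def)
        qed
      qed
    qed
  qed
qed

section \<open>Strong unicity\<close>

lemma product_exponent_le:
  assumes "l \<le> n"
  shows "real (l * (n + 1 - l)) \<le> real n * (real n + 3) / 4"
proof (cases "n = 0")
  case False
  have "real (n + 1 - l) = real n + 1 - real l" using assms by (simp add: of_nat_diff)
  then have "4 * real (l * (n + 1 - l)) = (real n + 1) ^ 2 - (real n + 1 - 2 * real l) ^ 2"
    unfolding of_nat_mult by (simp only:) (simp add: power2_eq_square algebra_simps)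
  also have "\<dots> \<le> (real n + 1) ^ 2" by simp
  also have "\<dots> \<le> real n * (real n + 3)" using False by (cases n) (simp_all add: power2_eq_square algebra_simps)
  finally show ?thesis by simp
qed (use assms in simp)

lemma powr_le_power:
  assumes "0 < x" "x \<le> 1" "real k \<le> \<mu>"
  shows "x powr \<mu> \<le> x ^ k"
  using powr_mono'[OF assms(3), of x] assms(1,2) by (simp add: powr_realpow)

text \<open>The exponent \<open>\<mu>\<close> bounds all exponents \<open>l (n + 1 - l)\<close>, and it occurs once for the correcting polynomial
  (base \<open>\<kappa>\<close>) and once for the interpolation (base \<open>2 \<kappa>\<close>).  What remains of
  \<open>n\<^sup>2 / 2 + 2 n\<close> is \<open>n / 2\<close>, which together with the factor \<open>2 powr \<mu>\<close> absorbs the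
  factor \<open>2 ^ n\<close> from the coefficient bound.\<close>
lemma exponent_bookkeeping:
  fixes n :: nat and \<kappa> F :: real
  assumes "0 < \<kappa>" "\<kappa> \<le> 1 / 2" "0 \<le> F"
  defines "\<mu> \<equiv> real n * (real n + 3) / 4"
  shows "\<kappa> powr (real n ^ 2 / 2 + 2 * real n) * (3 * (1 + real n * (2 ^ n * F))) \<le>
    10 * (real n * F + 1) * (\<kappa> powr \<mu> * (2 * \<kappa>) powr \<mu>)"
proof -
  have "\<kappa> powr (real n / 2) \<le> (1 / 2) powr (real n / 2)"
    using assms by (intro powr_mono2) auto
  then have "2 powr (real n / 2) * \<kappa> powr (real n / 2) \<le> 2 powr (real n / 2) * (1 / 2) powr (real n / 2)"
    by (rule mult_left_mono) simp
  also have "\<dots> = 1" by (simp add: powr_mult[symmetric])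
  finally have half: "2 powr (real n / 2) * \<kappa> powr (real n / 2) \<le> 1" .
  have "(2::real) ^ n = 2 powr (real n / 2) * 2 powr (real n / 2)"
    by (simp add: powr_add[symmetric] powr_realpow)
  then have "2 ^ n * \<kappa> powr (real n / 2) = 2 powr (real n / 2) * (2 powr (real n / 2) * \<kappa> powr (real n / 2))"
    by simp
  also have "\<dots> \<le> 2 powr \<mu> * 1"
    using half by (intro mult_mono powr_mono) (auto simp: \<mu>_def field_simps)
  finally have main: "2 ^ n * \<kappa> powr (real n / 2) \<le> 2 powr \<mu>" by simp
  have exps: "real n ^ 2 / 2 + 2 * real n = \<mu> + \<mu> + real n / 2"
    by (simp add: \<mu>_def power2_eq_square field_simps)
  have "1 + real n * (2 ^ n * F) \<le> 2 ^ n * (real n * F + 1)"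
    by (simp add: algebra_simps)
  then have "\<kappa> powr (real n ^ 2 / 2 + 2 * real n) * (3 * (1 + real n * (2 ^ n * F))) \<le>
      \<kappa> powr (real n ^ 2 / 2 + 2 * real n) * (3 * (2 ^ n * (real n * F + 1)))"
    by (intro mult_left_mono) auto
  also have "\<dots> = 3 * (real n * F + 1) * (\<kappa> powr \<mu> * \<kappa> powr \<mu>) * (2 ^ n * \<kappa> powr (real n / 2))"
    unfolding exps powr_add by (simp add: mult_ac)
  also have "\<dots> \<le> 10 * (real n * F + 1) * (\<kappa> powr \<mu> * \<kappa> powr \<mu>) * 2 powr \<mu>"
    using main assms(3) by (intro mult_mono) auto
  also have "\<dots> = 10 * (real n * F + 1) * (\<kappa> powr \<mu> * (2 * \<kappa>) powr \<mu>)"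
    using assms(1) by (simp add: powr_mult mult_ac)
  finally show ?thesis .
qed

lemma F_const_nonneg: "0 \<le> F_const n"
proof -
  have "(2 * real n ^ 2) ^ 0 / fact 0 \<le> Max ((\<lambda>i. (2 * real n ^ 2) ^ i / fact i) ` {0..n})"
    by (intro Max_ge imageI) auto
  then show ?thesis by (simp add: F_const_def)
qed

text \<open>Each non-constant coefficient of \<open>w\<close> is between \<open>0\<close> and twice that of \<open>p - y\<close>, so for \<open>t \<le> 1 / 2\<close> the step stays
  between the coefficients of \<open>y\<close> and \<open>p\<close>.\<close>
lemma coeff_box_step:
  assumes y: "y \<in> coeff_box n m k a b" and p: "p \<in> coeff_box n m k a b"
    and k: "\<forall>i\<in>{1..m}. 0 < k i"
    and w: "degree w \<le> n" "\<And>i. 0 < i \<Longrightarrow> \<bar>coeff w i - coeff (p - y) i\<bar> \<le> \<bar>coeff (p - y) i\<bar>"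
    and t: "0 \<le> t" "t \<le> 1 / 2"
  shows "y + Polynomial.smult t w \<in> coeff_box n m k a b"
  unfolding coeff_box_def poly_space_def
proof (intro CollectI conjI ballI)
  show "degree (y + Polynomial.smult t w) \<le> n"
    using y w(1) degree_smult_le[of t w]
    by (auto simp: coeff_box_def poly_space_def intro!: degree_add_le)
next
  fix i assume i: "i \<in> {1..m}"
  define Y P W where "Y = coeff y (k i)" and "P = coeff p (k i)" and "W = coeff w (k i)"
  have W: "\<bar>W - (P - Y)\<bar> \<le> \<bar>P - Y\<bar>" using w(2)[of "k i"] k i by (simp add: Y_def P_def W_def)
  have between: "min Y P \<le> Y + t * W \<and> Y + t * W \<le> max Y P"
  proof (cases "Y \<le> P")
    case True
    then have "0 \<le> W" "W \<le> 2 * (P - Y)" using W by auto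
    then have "0 \<le> t * W" "t * W \<le> 1 / 2 * (2 * (P - Y))"
      using t by (simp, intro mult_mono) auto
    then show ?thesis using True by simp
  next
    case False
    then have "0 \<le> - W" "- W \<le> 2 * (Y - P)" using W by auto
    then have "0 \<le> t * (- W)" "t * (- W) \<le> 1 / 2 * (2 * (Y - P))"
      using t by (intro mult_nonneg_nonneg, simp_all only:, intro mult_mono) auto
    then show ?thesis using False by simp
  qed
  have "a i \<le> ereal (min Y P)" "ereal (max Y P) \<le> b i"
    using y p i by (auto simp: coeff_box_def Y_def P_def min_def max_def)
  moreover have "ereal (min Y P) \<le> ereal (Y + t * W)" "ereal (Y + t * W) \<le> ereal (max Y P)"
    using between by (simp_all only: ereal_less_eq)
  ultimately show "a i \<le> ereal (coeff (y + Polynomial.smult t w) (k i))"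
    and "ereal (coeff (y + Polynomial.smult t w) (k i)) \<le> b i"
    unfolding Y_def P_def W_def coeff_add coeff_smult by (meson order_trans)+
qed

text \<open>Within a distance below \<open>\<chi>(L / 2)\<close> the function \<open>f\<close> varies by less than \<open>L / 4\<close> and \<open>y\<close> by at
  most \<open>L / 2\<close>, whereas \<open>f - y\<close> differs by at least \<open>2 (E - \<eta>) \<ge> E\<close> between the two points.\<close>
lemma opposite_extrema_separated:
  assumes mod: "modulus_of_uniform_continuity \<omega> f" and deg: "degree y \<le> n"
    and y: "sup_norm (poly y) \<le> M" and L: "0 < L" "L \<le> E" and \<eta>: "\<eta> \<le> E / 2"
    and x: "x \<in> {0..1}" "E - \<eta> \<le> \<bar>f x - poly y x\<bar>"
    and x': "x' \<in> {0..1}" "E - \<eta> \<le> \<bar>f x' - poly y x'\<bar>"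
    and sgn: "sgn (f x - poly y x) \<noteq> sgn (f x' - poly y x')"
  shows "chi \<omega> n M (L / 2) \<le> \<bar>x - x'\<bar>"
proof (rule ccontr)
  assume "\<not> ?thesis"
  then have lt: "\<bar>x - x'\<bar> < \<omega> (L / 4)" "\<bar>x - x'\<bar> < L / 2 / (4 * real n ^ 2 * M + 1)"
    by (simp_all add: chi_def)
  have f: "\<bar>f x - f x'\<bar> < L / 4"
  proof -
    have "0 < L / 4" using L(1) by simp
    then show ?thesis using mod lt(1) x(1) x'(1) unfolding modulus_of_uniform_continuity_def by blast
  qed
  have yb: "\<bar>poly y t\<bar> \<le> M" if "t \<in> {0..1}" for t
    using abs_le_sup_norm[of "poly y" t] y that by (force intro: continuous_intros)
  have M: "0 \<le> M" using yb[of 0] by simp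
  define C where "C = 4 * real n ^ 2 * M"
  have C: "0 \<le> C" using M by (simp add: C_def)
  have "\<bar>poly y x - poly y x'\<bar> \<le> C * \<bar>x - x'\<bar>"
    unfolding C_def by (rule poly_Lipschitz[OF deg yb x(1) x'(1)])
  also have "\<dots> \<le> C * (L / 2 / (C + 1))"
    using lt(2) C by (intro mult_left_mono) (auto simp: C_def)
  also have "\<dots> \<le> L / 2" using C L(1) by (simp add: field_simps)
  finally have "\<bar>poly y x - poly y x'\<bar> \<le> L / 2" .
  then have "\<bar>(f x - poly y x) - (f x' - poly y x')\<bar> < 3 * L / 4" using f by linarith
  moreover have "E \<le> \<bar>(f x - poly y x) - (f x' - poly y x')\<bar>"
    using x(2) x'(2) \<eta> L sgn by (auto simp: sgn_if split: if_splits)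
  ultimately show False using L by linarith
qed

theorem mainTheorem2:
  fixes n m :: nat and k :: "nat \<Rightarrow> nat" and a b :: "nat \<Rightarrow> ereal"
    and K :: "real poly set" and p0 y :: "real poly"
    and f \<omega> :: "real \<Rightarrow> real" and M E L \<gamma> :: real
  assumes "m \<le> n"
    and "strict_mono_on {1..m} k"
    and "\<forall>i\<in>{1..m}. 0 < k i \<and> k i \<le> n"
    and "\<forall>i\<in>{1..m}. a i \<le> b i \<and> a i \<noteq> \<infinity> \<and> b i \<noteq> -\<infinity>"
    and "K = coeff_box n m k a b"
    and "p0 \<in> K"
    and "modulus_of_uniform_continuity \<omega> f"
    and "M = 5 / 2 * sup_norm f + 3 / 2 * sup_norm (poly p0)"
    and "y \<in> K"
    and "E = sup_norm (\<lambda>x. f x - poly y x)"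
    and "\<forall>q\<in>K. E \<le> sup_norm (\<lambda>x. f x - poly q x)"
    and "E > 0"
    and "L \<in> {0<..E}"
    and "\<gamma> = (chi \<omega> n M (L / 2) / 2) powr (real n ^ 2 / 2 + 2 * real n)
           / (10 * N_const n ^ 2 * (real n + 1) * (real n * F_const n + 1))"
  shows "\<gamma> > 0 \<and>
    (\<forall>p\<in>K. sup_norm (\<lambda>x. f x - poly p x) \<ge> E + \<gamma> * sup_norm (\<lambda>x. poly p x - poly y x))"
proof -
  note K = assms(5) and mod = assms(7) and E = assms(10) and best = assms(11)
  have L: "0 < L" "L \<le> E" using assms(13) by auto
  have cont_f: "continuous_on {0..1} f" using mod by (rule modulus_imp_continuous)
  have cont: "continuous_on {0..1} (\<lambda>x. f x - poly q x)" for q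
    using cont_f by (intro continuous_intros)
  have cont_poly: "continuous_on {0..1} (poly q)" for q :: "real poly" by (intro continuous_intros)
  have degK: "degree q \<le> n" if "q \<in> K" for q using that by (simp add: K coeff_box_def poly_space_def)
  have norm_pos: "0 \<le> sup_norm f" "0 \<le> sup_norm (poly p0)"
    using abs_le_sup_norm[OF cont_f, of 0] abs_le_sup_norm[OF cont_poly[of p0], of 0] by auto
  have M: "0 \<le> M" unfolding assms(8) using norm_pos by simp
  have y_le_M: "sup_norm (poly y) \<le> M"
  proof (rule sup_norm_le)
    fix x :: real assume x: "x \<in> {0..1}"
    have "E \<le> sup_norm f + sup_norm (poly p0)"
    proof (rule order_trans[OF best[rule_format, OF assms(6)] sup_norm_le])
      fix t :: real assume t: "t \<in> {0..1}"
      show "\<bar>f t - poly p0 t\<bar> \<le> sup_norm f + sup_norm (poly p0)"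
        using abs_le_sup_norm[OF cont_f t] abs_le_sup_norm[OF cont_poly t, of p0] by linarith
    qed
    then show "\<bar>poly y x\<bar> \<le> M"
      using abs_le_sup_norm[OF cont_f x] abs_le_sup_norm[OF cont x, of y] norm_pos
      unfolding assms(8) E by linarith
  qed
  define d where "d = chi \<omega> n M (L / 2)"
  have "0 < \<omega> (L / 4)" using mod L(1) by (simp add: modulus_of_uniform_continuity_def)
  then have d: "0 < d" "d \<le> 1" using L M by (simp_all add: d_def chi_def divide_pos_pos add_nonneg_pos)
  define \<kappa> where "\<kappa> = d / 2"
  have \<kappa>: "0 < \<kappa>" "\<kappa> \<le> 1 / 2" "2 * \<kappa> = d" using d by (auto simp: \<kappa>_def)
  define N where "N = N_const n"
  define F where "F = 2 ^ n * F_const n"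
  have N: "1 \<le> N" unfolding N_def by (rule N_const_ge_1)
  have F: "0 \<le> F" by (simp add: F_def F_const_nonneg)
  define D where "D = 10 * N ^ 2 * (real n + 1) * (real n * F_const n + 1)"
  have D: "0 < D" unfolding D_def using N F_const_nonneg[of n]
    by (intro mult_pos_pos) (auto simp: add_nonneg_pos)
  have \<gamma>: "\<gamma> = \<kappa> powr (real n ^ 2 / 2 + 2 * real n) / D"
    by (simp add: assms(14) \<kappa>_def d_def D_def N_def)
  have \<gamma>_pos: "0 < \<gamma>" unfolding \<gamma> using \<kappa>(1) D by simp
  define \<mu> where "\<mu> = real n * (real n + 3) / 4"
  define T where "T = (real n + 1) * N ^ 2 * (3 * (1 + real n * F))"
  have T: "0 < T" unfolding T_def using N F by (intro mult_pos_pos) (auto simp: add_pos_nonneg)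
  have \<gamma>_le: "\<gamma> \<le> d powr \<mu> / T * \<kappa> powr \<mu>"
  proof -
    have "\<kappa> powr (real n ^ 2 / 2 + 2 * real n) * T =
        (real n + 1) * N ^ 2 * (\<kappa> powr (real n ^ 2 / 2 + 2 * real n) * (3 * (1 + real n * F)))"
      by (simp add: T_def mult_ac)
    also have "\<dots> \<le> (real n + 1) * N ^ 2 * (10 * (real n * F_const n + 1) * (\<kappa> powr \<mu> * d powr \<mu>))"
      using exponent_bookkeeping[OF \<kappa>(1,2) F_const_nonneg, of n]
      unfolding F_def \<mu>_def \<kappa>(3) by (intro mult_left_mono) auto
    also have "\<dots> = d powr \<mu> * \<kappa> powr \<mu> * D" by (simp add: D_def mult_ac)
    finally show ?thesis unfolding \<gamma> using D T by (simp add: field_simps)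
  qed
  have "E + \<gamma> * sup_norm (\<lambda>x. poly p x - poly y x) \<le> sup_norm (\<lambda>x. f x - poly p x)" if p: "p \<in> K" for p
  proof (rule ccontr)
    assume neg: "\<not> ?thesis"
    define q where "q = p - y"
    define Q where "Q = sup_norm (poly q)"
    have Q_eq: "sup_norm (\<lambda>x. poly p x - poly y x) = Q"
      unfolding Q_def q_def by (rule arg_cong[where f = sup_norm]) (simp add: fun_eq_iff)
    define \<delta>0 where "\<delta>0 = sup_norm (\<lambda>x. f x - poly p x) - E"
    have \<delta>0: "0 \<le> \<delta>0" "\<delta>0 < \<gamma> * Q" using neg best p unfolding Q_eq \<delta>0_def by auto
    then have Q: "0 < Q" using \<gamma>_pos by (metis le_less_trans zero_less_mult_pos)
    \<comment> \<open>The gap between \<open>\<delta>0\<close> and \<open>\<gamma> * Q\<close> leaves room for replacing extremal points by near-extremal ones.\<close>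
    define \<eta> where "\<eta> = min (E / 2) ((\<gamma> * Q - \<delta>0) / 2)"
    have \<eta>: "0 < \<eta>" "\<eta> \<le> E / 2" "\<eta> < E" "\<delta>0 + \<eta> < \<gamma> * Q"
      using assms(12) \<delta>0 by (auto simp: \<eta>_def min_def field_simps)
    define e where "e x = f x - poly y x" for x
    have e_le: "\<bar>e x\<bar> \<le> E" if "x \<in> {0..1}" for x
      using abs_le_sup_norm[OF cont that, of y] by (simp add: e_def E)
    \<comment> \<open>With this scale the interpolation bound comes out as at most two thirds of \<open>Q\<close>.\<close>
    define \<tau> where "\<tau> = Q * d powr \<mu> / T"
    have \<tau>: "0 < \<tau>" using Q d T by (simp add: \<tau>_def)
    obtain w c where w: "0 < c" "degree w \<le> n"
      "\<And>i. 0 < i \<Longrightarrow> \<bar>coeff w i - coeff q i\<bar> \<le> \<bar>coeff q i\<bar>"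
      "\<And>x. x \<in> {x \<in> {0..1}. E - \<eta> \<le> \<bar>e x\<bar>} \<Longrightarrow> c \<le> sgn (e x) * poly w x"
    proof (rule exists_descent_direction[OF \<eta>(3) d _ \<tau>, of q n Q e "\<delta>0 + \<eta>"])
      show "degree q \<le> n" unfolding q_def using degK p assms(9) by (intro degree_diff_le) auto
      show "Q \<le> B" if "\<And>x. x \<in> {0..1} \<Longrightarrow> \<bar>poly q x\<bar> \<le> B" for B
        unfolding Q_def using that by (rule sup_norm_le)
      show "d \<le> \<bar>x - x'\<bar>" if "x \<in> {x \<in> {0..1}. E - \<eta> \<le> \<bar>e x\<bar>}" "x' \<in> {x \<in> {0..1}. E - \<eta> \<le> \<bar>e x\<bar>}"
        "sgn (e x) \<noteq> sgn (e x')" for x x'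
        unfolding d_def
        by (rule opposite_extrema_separated[OF mod degK[OF assms(9)] y_le_M L \<eta>(2)])
          (use that in \<open>auto simp: e_def\<close>)
      show "- (\<delta>0 + \<eta>) \<le> sgn (e x) * poly q x" if "x \<in> {x \<in> {0..1}. E - \<eta> \<le> \<bar>e x\<bar>}" for x
      proof -
        have "\<bar>e x - poly q x\<bar> \<le> E + \<delta>0"
          using abs_le_sup_norm[OF cont, of x p] that by (simp add: e_def q_def \<delta>0_def)
        then show ?thesis using that \<eta>(3) by (auto simp: sgn_if)
      qed
      show "\<delta>0 + \<eta> < \<tau> * (d / 2) ^ (l * (n + 1 - l))" if l: "l \<le> n" for l
      proof -
        have "\<gamma> * Q \<le> d powr \<mu> / T * \<kappa> powr \<mu> * Q" using \<gamma>_le Q by (intro mult_right_mono) auto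
        also have "\<dots> = \<tau> * \<kappa> powr \<mu>" by (simp add: \<tau>_def)
        also have "\<dots> \<le> \<tau> * \<kappa> ^ (l * (n + 1 - l))"
          unfolding \<mu>_def using \<tau> \<kappa> by (intro mult_left_mono powr_le_power product_exponent_le l) auto
        finally show ?thesis using \<eta>(4) by (simp add: \<kappa>_def)
      qed
      show "real (n + 1) * N_const n * (2 * \<tau> * N_const n + real n * (\<tau> * (2 ^ n * F_const n) * N_const n)) /
        d ^ (r * (n + 1 - r)) + real n * (\<tau> * (2 ^ n * F_const n) * N_const n) < Q" if r: "r \<le> n" for r
      proof -
        define \<Lambda> where "\<Lambda> = (real n + 1) * N ^ 2"
        have \<Lambda>: "0 < \<Lambda>" "N \<le> \<Lambda>"
        proof -
          have "N * 1 \<le> N * ((real n + 1) * N)" using N by (intro mult_left_mono mult_ge1_I) auto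
          then show "N \<le> \<Lambda>" by (simp add: \<Lambda>_def power2_eq_square mult_ac)
          then show "0 < \<Lambda>" using N by linarith
        qed
        define G where "G = 1 + real n * F"
        have G: "1 \<le> G" using F by (simp add: G_def)
        have \<tau>\<Lambda>: "\<tau> * \<Lambda> = Q * d powr \<mu> / (3 * G)"
          using \<Lambda>(1) by (simp add: \<tau>_def T_def \<Lambda>_def[symmetric] G_def[symmetric])
        have dr: "0 < d powr \<mu>" "d powr \<mu> \<le> d ^ (r * (n + 1 - r))" "d powr \<mu> \<le> 1"
          using d powr_le_power[OF d product_exponent_le[OF r]] powr_le_power[OF d, of 0 \<mu>]
          by (auto simp: \<mu>_def)
        have "real (n + 1) * N_const n * (2 * \<tau> * N_const n + real n * (\<tau> * (2 ^ n * F_const n) * N_const n)) =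
            \<tau> * \<Lambda> * (G + 1)"
          by (simp add: \<Lambda>_def G_def F_def N_def power2_eq_square algebra_simps)
        then have "real (n + 1) * N_const n * (2 * \<tau> * N_const n + real n * (\<tau> * (2 ^ n * F_const n) * N_const n)) /
            d ^ (r * (n + 1 - r)) = \<tau> * \<Lambda> * (G + 1) / d ^ (r * (n + 1 - r))" by (simp only:)
        also have "\<dots> \<le> \<tau> * \<Lambda> * (G + 1) / d powr \<mu>"
          using \<tau> \<Lambda> G dr d(1) by (intro divide_left_mono mult_nonneg_nonneg mult_pos_pos) auto
        also have "\<dots> = Q * (G + 1) / (3 * G)" using dr(1) by (simp add: \<tau>\<Lambda>)
        finally have 1: "real (n + 1) * N_const n * (2 * \<tau> * N_const n + real n * (\<tau> * (2 ^ n * F_const n) * N_const n)) /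
          d ^ (r * (n + 1 - r)) \<le> Q * (G + 1) / (3 * G)" .
        have "real n * (\<tau> * (2 ^ n * F_const n) * N_const n) = \<tau> * N * (G - 1)"
          by (simp add: G_def F_def N_def)
        also have "\<dots> \<le> \<tau> * \<Lambda> * (G - 1)" using \<tau> \<Lambda> G by (intro mult_right_mono mult_left_mono) auto
        also have "\<dots> = d powr \<mu> * (Q * (G - 1) / (3 * G))" by (simp add: \<tau>\<Lambda>)
        also have "\<dots> \<le> 1 * (Q * (G - 1) / (3 * G))"
          using dr(3) Q G by (intro mult_right_mono) auto
        finally have 2: "real n * (\<tau> * (2 ^ n * F_const n) * N_const n) \<le> Q * (G - 1) / (3 * G)" by simp
        have "Q * (G + 1) / (3 * G) + Q * (G - 1) / (3 * G) = 2 / 3 * Q" using G by (simp add: field_simps)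
        then show ?thesis using 1 2 Q by linarith
      qed
    qed blast
    have w_bound: "\<bar>poly w x\<bar> \<le> sup_norm (poly w)" if "x \<in> {0..1}" for x
      using abs_le_sup_norm[OF cont_poly that] .
    have descent: "c \<le> sgn (e x) * poly w x" if "x \<in> {0..1}" "E - \<eta> \<le> \<bar>e x\<bar>" for x
      using w(4) that by simp
    obtain t where t: "0 < t" "t \<le> 1 / 2" "sup_norm (\<lambda>x. e x - t * poly w x) < E"
      using small_step_decreases_error[of e E "poly w" "sup_norm (poly w)" \<eta> c,
          OF e_le w_bound \<eta>(1,3) w(1) descent] by blast
    have "y + Polynomial.smult t w \<in> K"
      unfolding K using assms(3,9) p K w t unfolding q_def by (intro coeff_box_step[of y n m k a b p]) auto
    then have "E \<le> sup_norm (\<lambda>x. f x - poly (y + Polynomial.smult t w) x)" using best by blast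
    also have "(\<lambda>x. f x - poly (y + Polynomial.smult t w) x) = (\<lambda>x. e x - t * poly w x)"
      by (simp add: e_def fun_eq_iff)
    finally show False using t(3) by simp
  qed
  then show ?thesis using \<gamma>_pos by blast
qed

end
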